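(* Let $\mathcal T$ be a compactly generated triangulated category and let $\mathcal X$ be a smashing subcategory of $\mathcal T$. Denote by $\mathfrak I$ the ideal of all morphisms between compact objects of $\mathcal T$ which factor through some object in $\mathcal X$. Then the following are equivalent for a countable object $X\in\mathcal T$: (1) $X\in\mathcal X$; (2) $X$ is the homotopy colimit of a countable direct system $(X_n,\varphi_n)_{n<\omega}$ of compact objects (with $\varphi_n:X_n\to X_{n+1}$) such that $\varphi_n\in\mathfrak I$ for every $n$.
   Context: Let $\mathcal T$ be a triangulated category with arbitrary set-indexed coproducts. An object $C\in\mathcal T$ is compact if the canonical map $\bigoplus_i\mathrm{Hom}_{\mathcal T}(C,X_i)\to\mathrm{Hom}_{\mathcal T}(C,\coprod_iX_i)$ is an isomorphism for every family $(X_i)$ of objects. $\mathcal T$ is compactly generated if the full subcategory $\mathcal T_0$ of compact objects is equivalent to a small category and any $X\in\mathcal T$ with $\mathrm{Hom}_{\mathcal T}(C,X)=0$ for all $C\in\mathcal T_0$ is zero. A full triangulated subcategory $\mathcal X$ of $\mathcal T$ is localizing if it is closed under coproducts formed in $\mathcal T$; strictly localizing if the inclusion $\mathcal X\to\mathcal T$ has a right adjoint; smashing if moreover this right adjoint preserves coproducts. The homotopy colimit of a sequence $X_0\xrightarrow{\varphi_0}X_1\xrightarrow{\varphi_1}\cdots$ in $\mathcal T$ is an object $X$ (unique up to non-unique isomorphism) in a triangle $\coprod_{i<\omega}X_i\xrightarrow{\Phi}\coprod_{i<\omega}X_i\to X\to\coprod_{i<\omega}X_i[1]$, where the restriction of $\Phi$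 to $X_i$ is the composite of $(\mathrm{id},-\varphi_i):X_i\to X_i\sqcup X_{i+1}$ with the canonical inclusion into the coproduct. An object is countable if it is isomorphic to the homotopy colimit of a sequence of maps $X_0\to X_1\to X_2\to\cdots$ between compact objects. *)

theory Defs
  imports "HOL-Algebra.Free_Abelian_Groups"
begin

section \<open>Categories, functors, coproducts\<close>

record ('o, 'm) precat =
  Ob :: "'o set"
  Ar :: "'m set"
  Dom :: "'m \<Rightarrow> 'o"
  Cod :: "'m \<Rightarrow> 'o"
  Ide :: "'o \<Rightarrow> 'm"
  Cmp :: "'m \<Rightarrow> 'm \<Rightarrow> 'm"  (infixl "\<bullet>\<index>" 70)

definition Hom :: "('o, 'm, 'z) precat_scheme \<Rightarrow> 'o \<Rightarrow> 'o \<Rightarrow> 'm set" where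
  "Hom C A B = {f \<in> Ar C. Dom C f = A \<and> Cod C f = B}"

locale category =
  fixes C :: "('o, 'm, 'z) precat_scheme" (structure)
  assumes Dom_Ob: "f \<in> Ar C \<Longrightarrow> Dom C f \<in> Ob C"
    and Cod_Ob: "f \<in> Ar C \<Longrightarrow> Cod C f \<in> Ob C"
    and Ide_Hom: "A \<in> Ob C \<Longrightarrow> Ide C A \<in> Hom C A A"
    and Cmp_Hom: "f \<in> Hom C A B \<Longrightarrow> g \<in> Hom C B D \<Longrightarrow> g \<bullet> f \<in> Hom C A D"
    and Cmp_assoc: "f \<in> Hom C A B \<Longrightarrow> g \<in> Hom C B D \<Longrightarrow> h \<in> Hom C D E
      \<Longrightarrow> (h \<bullet> g) \<bullet> f = h \<bullet> (g \<bullet> f)"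
    and Cmp_Ide: "f \<in> Hom C A B \<Longrightarrow> f \<bullet> Ide C A = f"
    and Ide_Cmp: "f \<in> Hom C A B \<Longrightarrow> Ide C B \<bullet> f = f"

definition is_iso_arrow :: "('o, 'm, 'z) precat_scheme \<Rightarrow> 'o \<Rightarrow> 'o \<Rightarrow> 'm \<Rightarrow> bool" where
  "is_iso_arrow C A B f \<longleftrightarrow> f \<in> Hom C A B \<and>
    (\<exists>g \<in> Hom C B A. g \<bullet>\<^bsub>C\<^esub> f = Ide C A \<and> f \<bullet>\<^bsub>C\<^esub> g = Ide C B)"

definition isomorphic :: "('o, 'm, 'z) precat_scheme \<Rightarrow> 'o \<Rightarrow> 'o \<Rightarrow> bool" where
  "isomorphic C A B \<longleftrightarrow> A \<in> Ob C \<and> B \<in> Ob C \<and> (\<exists>f. is_iso_arrow C A B f)"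

definition zero_object :: "('o, 'm, 'z) precat_scheme \<Rightarrow> 'o \<Rightarrow> bool" where
  "zero_object C Z \<longleftrightarrow> Z \<in> Ob C \<and>
    (\<forall>A \<in> Ob C. (\<exists>!f. f \<in> Hom C A Z) \<and> (\<exists>!f. f \<in> Hom C Z A))"

definition full_subcat :: "('o, 'm, 'z) precat_scheme \<Rightarrow> 'o set \<Rightarrow> ('o, 'm) precat" where
  "full_subcat C S = \<lparr>Ob = Ob C \<inter> S, Ar = {f \<in> Ar C. Dom C f \<in> S \<and> Cod C f \<in> S},
     Dom = Dom C, Cod = Cod C, Ide = Ide C, Cmp = Cmp C\<rparr>"

definition is_functor ::
  "('o1, 'm1, 'z1) precat_scheme \<Rightarrow> ('o2, 'm2, 'z2) precat_scheme
    \<Rightarrow> ('o1 \<Rightarrow> 'o2) \<Rightarrow> ('m1 \<Rightarrow> 'm2) \<Rightarrow> bool" where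
  "is_functor C D Fo Fa \<longleftrightarrow>
    (\<forall>A \<in> Ob C. Fo A \<in> Ob D \<and> Fa (Ide C A) = Ide D (Fo A)) \<and>
    (\<forall>A B. \<forall>f \<in> Hom C A B. Fa f \<in> Hom D (Fo A) (Fo B)) \<and>
    (\<forall>A B E. \<forall>f \<in> Hom C A B. \<forall>g \<in> Hom C B E.
       Fa (g \<bullet>\<^bsub>C\<^esub> f) = Fa g \<bullet>\<^bsub>D\<^esub> Fa f)"

definition is_equivalence ::
  "('o1, 'm1, 'z1) precat_scheme \<Rightarrow> ('o2, 'm2, 'z2) precat_scheme
    \<Rightarrow> ('o1 \<Rightarrow> 'o2) \<Rightarrow> ('m1 \<Rightarrow> 'm2) \<Rightarrow> bool" where
  "is_equivalence C D Fo Fa \<longleftrightarrow> is_functor C D Fo Fa \<and>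
    (\<forall>A \<in> Ob C. \<forall>B \<in> Ob C. bij_betw Fa (Hom C A B) (Hom D (Fo A) (Fo B))) \<and>
    (\<forall>E \<in> Ob D. \<exists>A \<in> Ob C. isomorphic D (Fo A) E)"

text \<open>For \<open>F : C \<rightarrow> D\<close> and \<open>G : D \<rightarrow> C\<close>, the bijections \<open>\<theta> A B\<close> from
  \<open>D(F A, B)\<close> to \<open>C(A, G B)\<close> are natural in \<open>A\<close> and \<open>B\<close>.\<close>

definition is_right_adjoint ::
  "('o1, 'm1, 'z1) precat_scheme \<Rightarrow> ('o2, 'm2, 'z2) precat_scheme
    \<Rightarrow> ('o1 \<Rightarrow> 'o2) \<Rightarrow> ('m1 \<Rightarrow> 'm2) \<Rightarrow> ('o2 \<Rightarrow> 'o1) \<Rightarrow> ('m2 \<Rightarrow> 'm1) \<Rightarrow> bool" where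
  "is_right_adjoint C D Fo Fa Go Ga \<longleftrightarrow>
    is_functor C D Fo Fa \<and> is_functor D C Go Ga \<and>
    (\<exists>\<theta>. (\<forall>A \<in> Ob C. \<forall>B \<in> Ob D.
           bij_betw (\<theta> A B) (Hom D (Fo A) B) (Hom C A (Go B))) \<and>
         (\<forall>A \<in> Ob C. \<forall>A' \<in> Ob C. \<forall>B \<in> Ob D. \<forall>B' \<in> Ob D.
           \<forall>a \<in> Hom C A' A. \<forall>h \<in> Hom D (Fo A) B. \<forall>b \<in> Hom D B B'.
             \<theta> A' B' (b \<bullet>\<^bsub>D\<^esub> h \<bullet>\<^bsub>D\<^esub> Fa a) = Ga b \<bullet>\<^bsub>C\<^esub> \<theta> A B h \<bullet>\<^bsub>C\<^esub> a))"

definition is_coproduct ::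
  "('o, 'm, 'z) precat_scheme \<Rightarrow> 'i set \<Rightarrow> ('i \<Rightarrow> 'o) \<Rightarrow> 'o \<Rightarrow> ('i \<Rightarrow> 'm) \<Rightarrow> bool" where
  "is_coproduct C I X P \<iota> \<longleftrightarrow>
    (\<forall>i \<in> I. X i \<in> Ob C) \<and> P \<in> Ob C \<and> (\<forall>i \<in> I. \<iota> i \<in> Hom C (X i) P) \<and>
    (\<forall>Y \<in> Ob C. \<forall>f. (\<forall>i \<in> I. f i \<in> Hom C (X i) Y) \<longrightarrow>
       (\<exists>!h. h \<in> Hom C P Y \<and> (\<forall>i \<in> I. h \<bullet>\<^bsub>C\<^esub> \<iota> i = f i)))"

section \<open>Smallness\<close>

text \<open>The words ``set'' and ``small'' refer to a universe \<open>U\<close>: a collection is small if it has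
  fewer elements than \<open>U\<close>, and up to reindexing every small family is indexed by a small
  subset of \<open>U\<close>.  Objects and arrows of a category may form larger collections.  If \<open>|U|\<close> is
  strongly inaccessible, these are the small sets of a Grothendieck universe.  Below \<open>U\<close> is only
  required to be uncountable, so this reading is included but HOL need not provide
  an inaccessible type.\<close>

definition small :: "'u set \<Rightarrow> 'a set \<Rightarrow> bool" where
  "small U A \<longleftrightarrow> |A| <o |U|"

definition has_small_coproducts :: "'u set \<Rightarrow> ('o, 'm, 'z) precat_scheme \<Rightarrow> bool" where
  "has_small_coproducts U C \<longleftrightarrow>
    (\<forall>I X. I \<subseteq> U \<and> small U I \<and> (\<forall>i \<in> I. X i \<in> Ob C) \<longrightarrow> (\<exists>P \<iota>. is_coproduct C I X P \<iota>))"

definition preserves_small_coproducts ::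
  "'u set \<Rightarrow> ('o1, 'm1, 'z1) precat_scheme \<Rightarrow> ('o2, 'm2, 'z2) precat_scheme
    \<Rightarrow> ('o1 \<Rightarrow> 'o2) \<Rightarrow> ('m1 \<Rightarrow> 'm2) \<Rightarrow> bool" where
  "preserves_small_coproducts U C D Fo Fa \<longleftrightarrow>
    (\<forall>I X P \<iota>. I \<subseteq> U \<and> small U I \<and> is_coproduct C I X P \<iota> \<longrightarrow>
       is_coproduct D I (\<lambda>i. Fo (X i)) (Fo P) (\<lambda>i. Fa (\<iota> i)))"

definition essentially_small :: "'u set \<Rightarrow> ('o, 'm, 'z) precat_scheme \<Rightarrow> bool" where
  "essentially_small U C \<longleftrightarrow>
    (\<exists>(D :: ('u, 'u) precat) Fo Fa.
       category D \<and> small U (Ob D) \<and> small U (Ar D) \<and> is_equivalence D C Fo Fa)"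

section \<open>Triangulated categories\<close>

text \<open>\<open>Tri T f g h\<close> says that \<open>A \<rightarrow> B \<rightarrow> C \<rightarrow> A[1]\<close>, with maps \<open>f\<close>, \<open>g\<close>, \<open>h\<close>, is a
  distinguished triangle; \<open>ShO\<close> and \<open>ShA\<close> are the object and arrow parts of the shift.\<close>

record ('o, 'm) tricat = "('o, 'm) precat" +
  Zer :: "'o \<Rightarrow> 'o \<Rightarrow> 'm"
  Add :: "'m \<Rightarrow> 'm \<Rightarrow> 'm"  (infixl "\<boxplus>\<index>" 65)
  ShO :: "'o \<Rightarrow> 'o"
  ShA :: "'m \<Rightarrow> 'm"
  Tri :: "'m \<Rightarrow> 'm \<Rightarrow> 'm \<Rightarrow> bool"

definition hom_group :: "('o, 'm, 'z) tricat_scheme \<Rightarrow> 'o \<Rightarrow> 'o \<Rightarrow> 'm monoid" where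
  "hom_group T A B = \<lparr>carrier = Hom T A B, mult = Add T, one = Zer T A B\<rparr>"

definition Neg :: "('o, 'm, 'z) tricat_scheme \<Rightarrow> 'm \<Rightarrow> 'm" where
  "Neg T f = inv\<^bsub>hom_group T (Dom T f) (Cod T f)\<^esub> f"

locale additive_category = category T for T :: "('o, 'm, 'z) tricat_scheme" (structure) +
  assumes hom_comm_group: "A \<in> Ob T \<Longrightarrow> B \<in> Ob T \<Longrightarrow> comm_group (hom_group T A B)"
    and Cmp_Add_right: "f \<in> Hom T A B \<Longrightarrow> f' \<in> Hom T A B \<Longrightarrow> g \<in> Hom T B D
      \<Longrightarrow> g \<bullet> (f \<boxplus> f') = (g \<bullet> f) \<boxplus> (g \<bullet> f')"
    and Cmp_Add_left: "f \<in> Hom T A B \<Longrightarrow> g \<in> Hom T B D \<Longrightarrow> g' \<in> Hom T B D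
      \<Longrightarrow> (g \<boxplus> g') \<bullet> f = (g \<bullet> f) \<boxplus> (g' \<bullet> f)"
    and ex_zero_object: "\<exists>Z. zero_object T Z"
    and ex_biproduct: "A \<in> Ob T \<Longrightarrow> B \<in> Ob T \<Longrightarrow>
      \<exists>P \<in> Ob T. \<exists>i \<in> Hom T A P. \<exists>j \<in> Hom T B P. \<exists>p \<in> Hom T P A. \<exists>q \<in> Hom T P B.
        p \<bullet> i = Ide T A \<and> q \<bullet> j = Ide T B \<and> q \<bullet> i = Zer T A B \<and> p \<bullet> j = Zer T B A \<and>
        (i \<bullet> p) \<boxplus> (j \<bullet> q) = Ide T P"

text \<open>The shift is only required to be an additive autoequivalence, which covers the convention
  that it is an automorphism.  \<open>octahedral\<close> completes the triangles on \<open>f\<close>, \<open>g\<close> and \<open>g \<bullet> f\<close>.\<close>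

locale triangulated_category = additive_category +
  assumes shift_equivalence: "is_equivalence T T (ShO T) (ShA T)"
    and shift_additive: "f \<in> Hom T A B \<Longrightarrow> f' \<in> Hom T A B
      \<Longrightarrow> ShA T (f \<boxplus> f') = ShA T f \<boxplus> ShA T f'"
    and Tri_Hom: "Tri T f g h \<Longrightarrow>
      \<exists>A B D. f \<in> Hom T A B \<and> g \<in> Hom T B D \<and> h \<in> Hom T D (ShO T A)"
    and Tri_iso: "\<lbrakk>Tri T f g h; f \<in> Hom T A B; g \<in> Hom T B D; h \<in> Hom T D (ShO T A);
        f' \<in> Hom T A' B'; g' \<in> Hom T B' D'; h' \<in> Hom T D' (ShO T A');
        is_iso_arrow T A A' a; is_iso_arrow T B B' b; is_iso_arrow T D D' d;
        b \<bullet> f = f' \<bullet> a; d \<bullet> g = g' \<bullet> b; ShA T a \<bullet> h = h' \<bullet> d\<rbrakk> \<Longrightarrow> Tri T f' g' h'"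
    and Tri_Ide: "A \<in> Ob T \<Longrightarrow> zero_object T Z
      \<Longrightarrow> Tri T (Ide T A) (Zer T A Z) (Zer T Z (ShO T A))"
    and ex_Tri: "f \<in> Ar T \<Longrightarrow> \<exists>g h. Tri T f g h"
    and Tri_rotate: "f \<in> Hom T A B \<Longrightarrow> g \<in> Hom T B D \<Longrightarrow> h \<in> Hom T D (ShO T A)
      \<Longrightarrow> Tri T f g h \<longleftrightarrow> Tri T g h (Neg T (ShA T f))"
    and Tri_morphism: "\<lbrakk>Tri T f g h; Tri T f' g' h'; a \<in> Hom T (Dom T f) (Dom T f');
        b \<in> Hom T (Cod T f) (Cod T f'); b \<bullet> f = f' \<bullet> a\<rbrakk>
      \<Longrightarrow> \<exists>d \<in> Hom T (Cod T g) (Cod T g'). d \<bullet> g = g' \<bullet> b \<and> ShA T a \<bullet> h = h' \<bullet> d"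
    and octahedral: "\<lbrakk>f \<in> Hom T A B; g \<in> Hom T B D;
        Tri T f u u'; Tri T g v v'; Tri T (g \<bullet> f) w w'\<rbrakk>
      \<Longrightarrow> \<exists>p \<in> Hom T (Cod T u) (Cod T w). \<exists>q \<in> Hom T (Cod T w) (Cod T v).
            Tri T p q (ShA T u \<bullet> v') \<and> p \<bullet> u = w \<bullet> g \<and> w' \<bullet> p = u' \<and>
            q \<bullet> w = v \<and> v' \<bullet> q = ShA T f \<bullet> w'"

section \<open>Compact objects and compact generation\<close>

text \<open>The external direct sum of the groups \<open>Hom(C, X i)\<close> is \<open>sum_group\<close>; the canonical map sends
  a finitely supported family \<open>x\<close> to the sum of the \<open>\<iota> i \<bullet> x i\<close>.\<close>

definition compact_objects :: "'u set \<Rightarrow> ('o, 'm, 'z) tricat_scheme \<Rightarrow> 'o set" where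
  "compact_objects U T = {C \<in> Ob T. \<forall>I X P \<iota>.
     I \<subseteq> U \<and> small U I \<and> is_coproduct T I X P \<iota> \<longrightarrow>
       (\<lambda>x. gfinprod (hom_group T C P) (\<lambda>i. \<iota> i \<bullet>\<^bsub>T\<^esub> x i) I)
         \<in> iso (sum_group I (\<lambda>i. hom_group T C (X i))) (hom_group T C P)}"

locale compactly_generated_triangulated_category =
  triangulated_category T for T :: "('o, 'm, 'z) tricat_scheme" (structure) and U :: "'u set" +
  assumes uncountable_universe: "natLeq <o |U|"
    and small_coproducts: "has_small_coproducts U T"
    and compact_essentially_small: "essentially_small U (full_subcat T (compact_objects U T))"
    and compact_generate: "X \<in> Ob T \<Longrightarrow>
      (\<And>C. C \<in> compact_objects U T \<Longrightarrow> Hom T C X = {Zer T C X}) \<Longrightarrow> zero_object T X"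

section \<open>Localizing and smashing subcategories\<close>

text \<open>Full subcategories are given by their sets of objects.\<close>

definition triangulated_subcategory :: "('o, 'm, 'z) tricat_scheme \<Rightarrow> 'o set \<Rightarrow> bool" where
  "triangulated_subcategory T S \<longleftrightarrow> S \<subseteq> Ob T \<and> (\<exists>Z \<in> S. zero_object T Z) \<and>
    (\<forall>A \<in> S. \<forall>B. isomorphic T A B \<longrightarrow> B \<in> S) \<and>
    (\<forall>A \<in> Ob T. A \<in> S \<longleftrightarrow> ShO T A \<in> S) \<and>
    (\<forall>f g h. Tri T f g h \<and> Dom T f \<in> S \<and> Cod T f \<in> S \<longrightarrow> Cod T g \<in> S)"

definition localizing_subcategory :: "'u set \<Rightarrow> ('o, 'm, 'z) tricat_scheme \<Rightarrow> 'o set \<Rightarrow> bool" where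
  "localizing_subcategory U T S \<longleftrightarrow> triangulated_subcategory T S \<and>
    (\<forall>I X P \<iota>. I \<subseteq> U \<and> small U I \<and> (\<forall>i \<in> I. X i \<in> S) \<and> is_coproduct T I X P \<iota> \<longrightarrow> P \<in> S)"

definition inclusion_right_adjoint ::
  "('o, 'm, 'z) tricat_scheme \<Rightarrow> 'o set \<Rightarrow> ('o \<Rightarrow> 'o) \<Rightarrow> ('m \<Rightarrow> 'm) \<Rightarrow> bool" where
  "inclusion_right_adjoint T S Go Ga \<longleftrightarrow>
    is_right_adjoint (full_subcat T S) T (\<lambda>A. A) (\<lambda>f. f) Go Ga"

definition strictly_localizing_subcategory ::
  "'u set \<Rightarrow> ('o, 'm, 'z) tricat_scheme \<Rightarrow> 'o set \<Rightarrow> bool" where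
  "strictly_localizing_subcategory U T S \<longleftrightarrow> localizing_subcategory U T S \<and>
    (\<exists>Go Ga. inclusion_right_adjoint T S Go Ga)"

definition smashing_subcategory :: "'u set \<Rightarrow> ('o, 'm, 'z) tricat_scheme \<Rightarrow> 'o set \<Rightarrow> bool" where
  "smashing_subcategory U T S \<longleftrightarrow> strictly_localizing_subcategory U T S \<and>
    (\<exists>Go Ga. inclusion_right_adjoint T S Go Ga \<and>
       preserves_small_coproducts U T (full_subcat T S) Go Ga)"

definition compact_ideal :: "'u set \<Rightarrow> ('o, 'm, 'z) tricat_scheme \<Rightarrow> 'o set \<Rightarrow> 'm set" where
  "compact_ideal U T S = {f \<in> Ar T.
     Dom T f \<in> compact_objects U T \<and> Cod T f \<in> compact_objects U T \<and>
     (\<exists>Y \<in> S. \<exists>g \<in> Hom T (Dom T f) Y. \<exists>h \<in> Hom T Y (Cod T f). f = h \<bullet>\<^bsub>T\<^esub> g)}"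

section \<open>Homotopy colimits\<close>

definition is_sequence ::
  "('o, 'm, 'z) precat_scheme \<Rightarrow> (nat \<Rightarrow> 'o) \<Rightarrow> (nat \<Rightarrow> 'm) \<Rightarrow> bool" where
  "is_sequence C X \<phi> \<longleftrightarrow> (\<forall>n. X n \<in> Ob C \<and> \<phi> n \<in> Hom C (X n) (X (Suc n)))"

text \<open>On the summand \<open>X i\<close>, the map \<open>\<Phi>\<close> is \<open>(id, -\<phi> i)\<close> followed by the canonical inclusion of
  \<open>X i \<squnion> X (i + 1)\<close>.\<close>

definition is_hocolim ::
  "('o, 'm, 'z) tricat_scheme \<Rightarrow> (nat \<Rightarrow> 'o) \<Rightarrow> (nat \<Rightarrow> 'm) \<Rightarrow> 'o \<Rightarrow> bool" where
  "is_hocolim T X \<phi> Y \<longleftrightarrow> is_sequence T X \<phi> \<and>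
    (\<exists>P \<iota> \<Phi> g h. is_coproduct T UNIV X P \<iota> \<and> \<Phi> \<in> Hom T P P \<and>
       (\<forall>i. \<Phi> \<bullet>\<^bsub>T\<^esub> \<iota> i = \<iota> i \<boxplus>\<^bsub>T\<^esub> (\<iota> (Suc i) \<bullet>\<^bsub>T\<^esub> Neg T (\<phi> i))) \<and>
       g \<in> Hom T P Y \<and> h \<in> Hom T Y (ShO T P) \<and> Tri T \<Phi> g h)"

definition countable_object :: "'u set \<Rightarrow> ('o, 'm, 'z) tricat_scheme \<Rightarrow> 'o \<Rightarrow> bool" where
  "countable_object U T Y \<longleftrightarrow>
    (\<exists>X \<phi> Y'. (\<forall>n. X n \<in> compact_objects U T) \<and> is_hocolim T X \<phi> Y' \<and> isomorphic T Y Y')"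

end

(*
  (2) ==> (1): if every phi_n factors through some Y_n in S, then Phi = 1 - HG for maps G, H between
  the coproduct of the X_n and that of the Y_n.  The cones of 1 - HG and 1 - GH are isomorphic, and
  the second one lies in S.

  (1) ==> (2): apply the coreflection onto S, which preserves coproducts, to the sequence (A_n) of
  compact objects and let X' be the homotopy colimit of the result.  As X is in S, the induced map
  X' -> X has a section.  A map from the compact object A_n to X' factors through a stage, so
  A_n -> X factors as A_n -> G(A_m) -> A_m -> X.  By compactness of A_n this identity already holds
  in some A_k, so A_n -> A_k factors through an object of S.  Finally pass to a subsequence.
*)
theory Submission
  imports Defs
begin

section \<open>Additive categories\<close>

text \<open>Cones are not functorial: \<open>Tri_morphism\<close> yields some map between third
  vertices, neither unique nor compatible with composition. Hence each comparison of homotopy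
  colimits needs its own argument. For \<open>1 - HG\<close> and \<open>1 - GH\<close> the
  composites of the chosen maps differ from the identity by an endomorphism of square zero. For a
  subsequence the comparison map is tested on compact objects: its cone receives no nonzero map from
  them, so it is zero by compact generation. For the coreflected sequence only a section is
  extracted; this uses the universal property of the coreflection for maps out of \<open>X\<close>,
  a member of \<open>S\<close>, and asks nothing of the new cone. Preservation of coproducts is what
  places the telescope of the coreflected sequence on the coreflection of the old coproduct, so that
  the counit becomes a map of telescopes. The coreflected stages need not be compact; only the
  sources \<open>A n\<close> are, and this suffices because the statements on maps into a homotopy
  colimit constrain the source alone.\<close>

lemma (in category) Hom_Ob:
  assumes "f \<in> Hom C A B" shows "A \<in> Ob C" "B \<in> Ob C"
  using assms Dom_Ob Cod_Ob by (auto simp: Hom_def)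

context additive_category
begin

lemma zer_hom: "A \<in> Ob T \<Longrightarrow> B \<in> Ob T \<Longrightarrow> Zer T A B \<in> Hom T A B"
  using monoid.one_closed[of "hom_group T A B"] hom_comm_group[of A B]
  by (auto simp: hom_group_def comm_group_def group_def)

lemma neg_eq: "f \<in> Hom T A B \<Longrightarrow> Neg T f = inv\<^bsub>hom_group T A B\<^esub> f"
  by (auto simp: Neg_def Hom_def)

lemma hom_group_of_hom: "f \<in> Hom T A B \<Longrightarrow> comm_group (hom_group T A B)"
  using hom_comm_group Hom_Ob by blast

lemma neg_hom: "f \<in> Hom T A B \<Longrightarrow> Neg T f \<in> Hom T A B"
  using group.inv_closed[of "hom_group T A B" f] hom_group_of_hom[of f A B]
  by (auto simp: neg_eq hom_group_def comm_group_def)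

lemma add_hom: "f \<in> Hom T A B \<Longrightarrow> g \<in> Hom T A B \<Longrightarrow> f \<boxplus> g \<in> Hom T A B"
  using monoid.m_closed[of "hom_group T A B" f g] hom_group_of_hom[of f A B]
  by (auto simp: hom_group_def comm_group_def group_def)

lemma add_assoc: "f \<in> Hom T A B \<Longrightarrow> g \<in> Hom T A B \<Longrightarrow> k \<in> Hom T A B
    \<Longrightarrow> (f \<boxplus> g) \<boxplus> k = f \<boxplus> (g \<boxplus> k)"
  using monoid.m_assoc[of "hom_group T A B" f g k] hom_group_of_hom[of f A B]
  by (auto simp: hom_group_def comm_group_def group_def)

lemma add_comm: "f \<in> Hom T A B \<Longrightarrow> g \<in> Hom T A B \<Longrightarrow> f \<boxplus> g = g \<boxplus> f"
  using comm_monoid.m_comm[of "hom_group T A B" f g] hom_group_of_hom[of f A B]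
  by (auto simp: hom_group_def comm_group_def)

lemma add_zer: "f \<in> Hom T A B \<Longrightarrow> f \<boxplus> Zer T A B = f"
  using monoid.r_one[of "hom_group T A B" f] hom_group_of_hom[of f A B]
  by (auto simp: hom_group_def comm_group_def group_def)

lemma zer_add: "f \<in> Hom T A B \<Longrightarrow> Zer T A B \<boxplus> f = f"
  using monoid.l_one[of "hom_group T A B" f] hom_group_of_hom[of f A B]
  by (auto simp: hom_group_def comm_group_def group_def)

lemma add_neg: "f \<in> Hom T A B \<Longrightarrow> f \<boxplus> Neg T f = Zer T A B"
  using group.r_inv[of "hom_group T A B" f] hom_group_of_hom[of f A B] neg_eq[of f A B]
  by (auto simp: hom_group_def comm_group_def)

lemma neg_unique:
  assumes "f \<in> Hom T A B" "g \<in> Hom T A B" "f \<boxplus> g = Zer T A B"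
  shows "g = Neg T f"
proof -
  note n = neg_hom[OF assms(1)]
  have "Neg T f = Neg T f \<boxplus> (f \<boxplus> g)" using assms(3) add_zer[OF n] by simp
  also have "\<dots> = (f \<boxplus> Neg T f) \<boxplus> g"
    using add_assoc[OF n assms(1,2)] add_comm[OF n assms(1)] by simp
  also have "\<dots> = g" using add_neg[OF assms(1)] zer_add[OF assms(2)] by simp
  finally show ?thesis by simp
qed

lemma neg_neg:
  assumes f: "f \<in> Hom T A B" shows "Neg T (Neg T f) = f"
  using neg_unique[OF neg_hom[OF f] f] add_comm[OF f neg_hom[OF f]] add_neg[OF f] by simp

lemma sub_eq_zer:
  assumes "f \<in> Hom T A B" "g \<in> Hom T A B" "f \<boxplus> Neg T g = Zer T A B"
  shows "f = g"
  using neg_unique[OF assms(1) neg_hom[OF assms(2)] assms(3)] neg_neg[OF assms(1)]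
    neg_neg[OF assms(2)] by simp

lemma sub_add_cancel:
  assumes "f \<in> Hom T A B" "g \<in> Hom T A B"
  shows "(f \<boxplus> Neg T g) \<boxplus> g = f"
  using add_assoc[OF assms(1) neg_hom[OF assms(2)] assms(2)] add_comm[OF neg_hom[OF assms(2)] assms(2)]
    add_neg[OF assms(2)] add_zer[OF assms(1)] by simp

text \<open>Cancellation in the Hom group. Together with additivity it shows that composition and
  the shift send zero maps to zero maps.\<close>

lemma add_idem_zer:
  assumes "f \<in> Hom T A B" "f \<boxplus> f = f" shows "f = Zer T A B"
  using add_assoc[OF assms(1,1) neg_hom[OF assms(1)]] assms(2) add_neg[OF assms(1)]
    add_zer[OF assms(1)] by simp

lemma cmp_zer:
  assumes "g \<in> Hom T B D" "A \<in> Ob T"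
  shows "g \<bullet> Zer T A B = Zer T A D"
proof -
  have z: "Zer T A B \<in> Hom T A B" using assms Hom_Ob zer_hom by blast
  have "g \<bullet> Zer T A B = (g \<bullet> Zer T A B) \<boxplus> (g \<bullet> Zer T A B)"
    using Cmp_Add_right[OF z z assms(1)] add_zer[OF z] by simp
  then show ?thesis using add_idem_zer[OF Cmp_Hom[OF z assms(1)]] by simp
qed

lemma zer_cmp:
  assumes "f \<in> Hom T A B" "D \<in> Ob T"
  shows "Zer T B D \<bullet> f = Zer T A D"
proof -
  have z: "Zer T B D \<in> Hom T B D" using assms Hom_Ob zer_hom by blast
  have "Zer T B D \<bullet> f = (Zer T B D \<bullet> f) \<boxplus> (Zer T B D \<bullet> f)"
    using Cmp_Add_left[OF assms(1) z z] add_zer[OF z] by simp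
  then show ?thesis using add_idem_zer[OF Cmp_Hom[OF assms(1) z]] by simp
qed

lemma cmp_neg:
  assumes "f \<in> Hom T A B" "g \<in> Hom T B D"
  shows "g \<bullet> Neg T f = Neg T (g \<bullet> f)"
  using neg_unique[OF Cmp_Hom[OF assms] Cmp_Hom[OF neg_hom[OF assms(1)] assms(2)]]
    Cmp_Add_right[OF assms(1) neg_hom[OF assms(1)] assms(2)] add_neg[OF assms(1)]
    cmp_zer[OF assms(2) Hom_Ob(1)[OF assms(1)]] by simp

lemma neg_cmp:
  assumes "f \<in> Hom T A B" "g \<in> Hom T B D"
  shows "Neg T g \<bullet> f = Neg T (g \<bullet> f)"
  using neg_unique[OF Cmp_Hom[OF assms] Cmp_Hom[OF assms(1) neg_hom[OF assms(2)]]]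
    Cmp_Add_left[OF assms neg_hom[OF assms(2)]] add_neg[OF assms(2)]
    zer_cmp[OF assms(1) Hom_Ob(2)[OF assms(2)]] by simp

lemma cmp_sub:
  assumes "f \<in> Hom T A B" "f' \<in> Hom T A B" "g \<in> Hom T B D"
  shows "g \<bullet> (f \<boxplus> Neg T f') = (g \<bullet> f) \<boxplus> Neg T (g \<bullet> f')"
  using Cmp_Add_right[OF assms(1) neg_hom[OF assms(2)] assms(3)] cmp_neg[OF assms(2,3)] by simp

lemma sub_cmp:
  assumes "f \<in> Hom T A B" "g \<in> Hom T B D" "g' \<in> Hom T B D"
  shows "(g \<boxplus> Neg T g') \<bullet> f = (g \<bullet> f) \<boxplus> Neg T (g' \<bullet> f)"
  using Cmp_Add_left[OF assms(1,2) neg_hom[OF assms(3)]] neg_cmp[OF assms(1,3)] by simp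

lemma neg_zer: "A \<in> Ob T \<Longrightarrow> B \<in> Ob T \<Longrightarrow> Neg T (Zer T A B) = Zer T A B"
  using neg_unique[OF zer_hom zer_hom add_zer[OF zer_hom]] by simp

lemma zero_object_hom_into: "zero_object T Z \<Longrightarrow> f \<in> Hom T A Z \<Longrightarrow> f = Zer T A Z"
  using Hom_Ob[of f A Z] zer_hom[of A Z] unfolding zero_object_def by blast

lemma zero_object_hom_from: "zero_object T Z \<Longrightarrow> f \<in> Hom T Z A \<Longrightarrow> f = Zer T Z A"
  using Hom_Ob[of f Z A] zer_hom[of Z A] unfolding zero_object_def by blast

lemma zero_object_if_Ide_zer:
  assumes "Z \<in> Ob T" "Ide T Z = Zer T Z Z"
  shows "zero_object T Z"
proof -
  have "f = Zer T A Z" if "f \<in> Hom T A Z" for f A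
    using that assms Ide_Cmp[OF that] zer_cmp[OF that assms(1)] by simp
  moreover have "f = Zer T Z A" if "f \<in> Hom T Z A" for f A
    using that assms Cmp_Ide[OF that] cmp_zer[OF that assms(1)] by simp
  ultimately show ?thesis
    unfolding zero_object_def using assms(1) zer_hom by blast
qed

text \<open>Both products are \<open>1 - e \<bullet> e\<close>. The case arises for endomorphisms of
  a cone, whose deviation from the identity turns out to have square zero.\<close>

lemma sub_square_zer_right_inverse:
  assumes e: "e \<in> Hom T A A" and "e \<bullet> e = Zer T A A"
  shows "(Ide T A \<boxplus> Neg T e) \<bullet> (Ide T A \<boxplus> e) = Ide T A"
    and "(Ide T A \<boxplus> e) \<bullet> (Ide T A \<boxplus> Neg T e) = Ide T A"
proof -
  have A: "A \<in> Ob T" and i: "Ide T A \<in> Hom T A A" using e Hom_Ob Ide_Hom by blast+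
  note h = neg_hom[OF e] add_hom[OF i neg_hom[OF e]] add_hom[OF i e]
  have "(Ide T A \<boxplus> Neg T e) \<bullet> (Ide T A \<boxplus> e)
      = (Ide T A \<boxplus> Neg T e) \<boxplus> (e \<boxplus> Neg T (Zer T A A))"
    using Cmp_Add_right[OF i e h(2)] Cmp_Ide[OF h(2)] sub_cmp[OF e i e] Ide_Cmp[OF e] assms(2)
    by simp
  also have "\<dots> = Ide T A"
    using add_zer[OF e] neg_zer[OF A A] sub_add_cancel[OF i e] by simp
  finally show "(Ide T A \<boxplus> Neg T e) \<bullet> (Ide T A \<boxplus> e) = Ide T A" .
  have "(Ide T A \<boxplus> e) \<bullet> (Ide T A \<boxplus> Neg T e)
      = (Ide T A \<boxplus> e) \<boxplus> Neg T (e \<boxplus> Zer T A A)"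
    using cmp_sub[OF i e h(3)] Cmp_Ide[OF h(3)] Cmp_Add_left[OF e i e] Ide_Cmp[OF e] assms(2)
    by simp
  also have "\<dots> = (Ide T A \<boxplus> e) \<boxplus> Neg T e" by (simp add: add_zer[OF e])
  also have "\<dots> = Ide T A"
    using add_assoc[OF i e h(1)] add_neg[OF e] add_zer[OF i] by simp
  finally show "(Ide T A \<boxplus> e) \<bullet> (Ide T A \<boxplus> Neg T e) = Ide T A" .
qed

end

section \<open>Isomorphisms and coproducts\<close>

context category
begin

text \<open>The one-sided inverses coincide because \<open>l = l f r = r\<close>. Later they come
  from unrelated sources, for instance from exactness for maps into and for maps out of a
  triangle.\<close>

lemma iso_arrowI:
  assumes "f \<in> Hom C A B" "l \<in> Hom C B A" "r \<in> Hom C B A"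
    and "l \<bullet> f = Ide C A" "f \<bullet> r = Ide C B"
  shows "is_iso_arrow C A B f"
proof -
  have "l = l \<bullet> (f \<bullet> r)" using assms Cmp_Ide by simp
  also have "\<dots> = r" using assms Cmp_assoc[of r B A f B l A] Ide_Cmp by metis
  finally show ?thesis using assms by (auto simp: is_iso_arrow_def)
qed

lemma iso_arrow_inverse:
  assumes "is_iso_arrow C A B f"
  obtains g where "g \<in> Hom C B A" "g \<bullet> f = Ide C A" "f \<bullet> g = Ide C B" "is_iso_arrow C B A g"
  using assms unfolding is_iso_arrow_def by blast

lemma iso_arrow_Ide: "A \<in> Ob C \<Longrightarrow> is_iso_arrow C A A (Ide C A)"
  using Ide_Hom Cmp_Ide unfolding is_iso_arrow_def by metis

lemma isomorphic_sym: "isomorphic C A B \<Longrightarrow> isomorphic C B A"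
  by (meson isomorphic_def iso_arrow_inverse)

lemma coproduct_hom: "is_coproduct C I X P \<iota> \<Longrightarrow> i \<in> I \<Longrightarrow> \<iota> i \<in> Hom C (X i) P"
  by (simp add: is_coproduct_def)

lemma coproduct_Ob:
  "is_coproduct C I X P \<iota> \<Longrightarrow> P \<in> Ob C"
  "is_coproduct C I X P \<iota> \<Longrightarrow> i \<in> I \<Longrightarrow> X i \<in> Ob C"
  by (simp_all add: is_coproduct_def)

lemma coproduct_lift:
  assumes "is_coproduct C I X P \<iota>" "Y \<in> Ob C" "\<And>i. i \<in> I \<Longrightarrow> f i \<in> Hom C (X i) Y"
  obtains h where "h \<in> Hom C P Y" "\<And>i. i \<in> I \<Longrightarrow> h \<bullet> \<iota> i = f i"
  using assms unfolding is_coproduct_def by metis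

lemma coproduct_eq:
  assumes "is_coproduct C I X P \<iota>" "h \<in> Hom C P Y" "k \<in> Hom C P Y"
    and "\<And>i. i \<in> I \<Longrightarrow> h \<bullet> \<iota> i = k \<bullet> \<iota> i"
  shows "h = k"
proof -
  have Y: "Y \<in> Ob C" using assms(2) Hom_Ob by blast
  have "\<forall>i\<in>I. h \<bullet> \<iota> i \<in> Hom C (X i) Y"
    using assms(1,2) Cmp_Hom by (auto simp: is_coproduct_def)
  then have "\<exists>!u. u \<in> Hom C P Y \<and> (\<forall>i\<in>I. u \<bullet> \<iota> i = h \<bullet> \<iota> i)"
    using assms(1) Y by (simp add: is_coproduct_def)
  then show ?thesis using assms(2-4) by metis
qed

lemma coproductI:
  assumes "P \<in> Ob C" "\<And>i. i \<in> I \<Longrightarrow> \<iota> i \<in> Hom C (X i) P"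
    and "\<And>Y f. Y \<in> Ob C \<Longrightarrow> (\<And>i. i \<in> I \<Longrightarrow> f i \<in> Hom C (X i) Y)
      \<Longrightarrow> \<exists>h \<in> Hom C P Y. \<forall>i\<in>I. h \<bullet> \<iota> i = f i"
    and "\<And>Y h k. h \<in> Hom C P Y \<Longrightarrow> k \<in> Hom C P Y \<Longrightarrow> (\<And>i. i \<in> I \<Longrightarrow> h \<bullet> \<iota> i = k \<bullet> \<iota> i) \<Longrightarrow> h = k"
  shows "is_coproduct C I X P \<iota>"
  unfolding is_coproduct_def
proof (intro conjI ballI allI impI)
  show "X i \<in> Ob C" if "i \<in> I" for i using assms(2)[OF that] Hom_Ob by blast
  show "\<exists>!h. h \<in> Hom C P Y \<and> (\<forall>i\<in>I. h \<bullet> \<iota> i = f i)"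
    if "Y \<in> Ob C" "\<forall>i\<in>I. f i \<in> Hom C (X i) Y" for Y f
  proof -
    have "\<exists>h\<in>Hom C P Y. \<forall>i\<in>I. h \<bullet> \<iota> i = f i" by (rule assms(3)) (use that in auto)
    then obtain h where "h \<in> Hom C P Y" "\<forall>i\<in>I. h \<bullet> \<iota> i = f i" by blast
    then show ?thesis using assms(4) by (intro ex1I[of _ h]) auto
  qed
qed (use assms in auto)

lemma coproduct_transport:
  assumes cop: "is_coproduct C I X P \<iota>" and u: "is_iso_arrow C P Q u"
    and k: "\<And>i. i \<in> I \<Longrightarrow> \<kappa> i = u \<bullet> \<iota> i"
  shows "is_coproduct C I X Q \<kappa>"
proof -
  obtain v where v: "v \<in> Hom C Q P" "v \<bullet> u = Ide C P" "u \<bullet> v = Ide C Q"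
    using u iso_arrow_inverse by metis
  have uh: "u \<in> Hom C P Q" using u by (simp add: is_iso_arrow_def)
  note io = coproduct_hom[OF cop]
  show ?thesis
  proof (rule coproductI)
    show "Q \<in> Ob C" using uh Hom_Ob by blast
    show "\<kappa> i \<in> Hom C (X i) Q" if "i \<in> I" for i using k[OF that] Cmp_Hom[OF io[OF that] uh] by simp
    fix Y f assume Y: "Y \<in> Ob C" and f: "\<And>i. i \<in> I \<Longrightarrow> f i \<in> Hom C (X i) Y"
    obtain h where h: "h \<in> Hom C P Y" "\<And>i. i \<in> I \<Longrightarrow> h \<bullet> \<iota> i = f i"
      using coproduct_lift[where f=f, OF cop Y f] by metis
    have "(h \<bullet> v) \<bullet> \<kappa> i = f i" if i: "i \<in> I" for i
    proof -
      have "(h \<bullet> v) \<bullet> \<kappa> i = h \<bullet> (v \<bullet> (u \<bullet> \<iota> i))"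
        using Cmp_assoc[OF Cmp_Hom[OF io[OF i] uh] v(1) h(1)] k[OF i] by simp
      also have "\<dots> = f i"
        using Cmp_assoc[OF io[OF i] uh v(1)] v(2) Ide_Cmp[OF io[OF i]] h(2)[OF i] by simp
      finally show ?thesis .
    qed
    then show "\<exists>h\<in>Hom C Q Y. \<forall>i\<in>I. h \<bullet> \<kappa> i = f i" using Cmp_Hom[OF v(1) h(1)] by blast
  next
    fix Y a b assume a: "a \<in> Hom C Q Y" and b: "b \<in> Hom C Q Y"
      and ab: "\<And>i. i \<in> I \<Longrightarrow> a \<bullet> \<kappa> i = b \<bullet> \<kappa> i"
    have "a \<bullet> u = b \<bullet> u"
    proof (rule coproduct_eq[OF cop Cmp_Hom[OF uh a] Cmp_Hom[OF uh b]])
      fix i assume i: "i \<in> I"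
      show "(a \<bullet> u) \<bullet> \<iota> i = (b \<bullet> u) \<bullet> \<iota> i"
        using Cmp_assoc[OF io[OF i] uh a] Cmp_assoc[OF io[OF i] uh b] ab[OF i] k[OF i] by simp
    qed
    then have "(a \<bullet> u) \<bullet> v = (b \<bullet> u) \<bullet> v" by simp
    then show "a = b"
      using Cmp_assoc[OF v(1) uh a] Cmp_assoc[OF v(1) uh b] v(3) Cmp_Ide[OF a] Cmp_Ide[OF b] by simp
  qed
qed

lemma coproduct_comparison:
  assumes P: "is_coproduct C I X P \<iota>" and Q: "is_coproduct C I X Q \<kappa>"
  obtains u where "is_iso_arrow C P Q u" "\<And>i. i \<in> I \<Longrightarrow> u \<bullet> \<iota> i = \<kappa> i"
proof -
  obtain u where u: "u \<in> Hom C P Q" "\<And>i. i \<in> I \<Longrightarrow> u \<bullet> \<iota> i = \<kappa> i"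
    using coproduct_lift[OF P coproduct_Ob(1)[OF Q] coproduct_hom[OF Q]] by metis
  obtain v where v: "v \<in> Hom C Q P" "\<And>i. i \<in> I \<Longrightarrow> v \<bullet> \<kappa> i = \<iota> i"
    using coproduct_lift[OF Q coproduct_Ob(1)[OF P] coproduct_hom[OF P]] by metis
  have "v \<bullet> u = Ide C P"
    using Cmp_assoc[OF coproduct_hom[OF P] u(1) v(1)] u(2) v(2) Ide_Cmp[OF coproduct_hom[OF P]]
    by (intro coproduct_eq[OF P Cmp_Hom[OF u(1) v(1)] Ide_Hom[OF coproduct_Ob(1)[OF P]]]) simp
  moreover have "u \<bullet> v = Ide C Q"
    using Cmp_assoc[OF coproduct_hom[OF Q] v(1) u(1)] u(2) v(2) Ide_Cmp[OF coproduct_hom[OF Q]]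
    by (intro coproduct_eq[OF Q Cmp_Hom[OF v(1) u(1)] Ide_Hom[OF coproduct_Ob(1)[OF Q]]]) simp
  ultimately show ?thesis using that[of u] u v by (auto simp: is_iso_arrow_def)
qed

text \<open>Small families are indexed by subsets of \<open>U\<close>, sequences by
  \<open>nat\<close>; reindexing in both directions moves coproducts between the two.\<close>

lemma coproduct_reindex:
  assumes b: "bij_betw f J I" and cop: "is_coproduct C J X P \<iota>"
  shows "is_coproduct C I (\<lambda>i. X (inv_into J f i)) P (\<lambda>i. \<iota> (inv_into J f i))"
proof -
  let ?g = "inv_into J f"
  have g: "?g i \<in> J" if "i \<in> I" for i using b that by (metis bij_betw_def inv_into_into)
  have fg: "f j \<in> I \<and> ?g (f j) = j" if "j \<in> J" for j
    using b that by (auto simp: bij_betw_def)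
  show ?thesis
  proof (rule coproductI)
    show "P \<in> Ob C" using cop by (rule coproduct_Ob)
    show "\<iota> (?g i) \<in> Hom C (X (?g i)) P" if "i \<in> I" for i using coproduct_hom[OF cop g[OF that]] .
    fix Y k assume Y: "Y \<in> Ob C" and k: "\<And>i. i \<in> I \<Longrightarrow> k i \<in> Hom C (X (?g i)) Y"
    have "k (f j) \<in> Hom C (X j) Y" if "j \<in> J" for j using k[of "f j"] fg[OF that] by simp
    then obtain h where h: "h \<in> Hom C P Y" "\<And>j. j \<in> J \<Longrightarrow> h \<bullet> \<iota> j = k (f j)"
      using coproduct_lift[OF cop Y, of "\<lambda>j. k (f j)"] by metis
    have "h \<bullet> \<iota> (?g i) = k i" if "i \<in> I" for i
      using h(2)[OF g[OF that]] b that by (simp add: bij_betw_def f_inv_into_f)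
    then show "\<exists>h\<in>Hom C P Y. \<forall>i\<in>I. h \<bullet> \<iota> (?g i) = k i" using h(1) by blast
  next
    fix Y a c assume ac: "a \<in> Hom C P Y" "c \<in> Hom C P Y"
      and e: "\<And>i. i \<in> I \<Longrightarrow> a \<bullet> \<iota> (?g i) = c \<bullet> \<iota> (?g i)"
    have "a \<bullet> \<iota> j = c \<bullet> \<iota> j" if "j \<in> J" for j using e[of "f j"] fg[OF that] by simp
    then show "a = c" using coproduct_eq[OF cop ac] by blast
  qed
qed

lemma coproduct_reindex_back:
  assumes b: "bij_betw f J I" and cop: "is_coproduct C I X P \<iota>"
  shows "is_coproduct C J (\<lambda>j. X (f j)) P (\<lambda>j. \<iota> (f j))"
proof -
  have fj: "f j \<in> I" if "j \<in> J" for j using b that by (auto simp: bij_betw_def)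
  have g: "inv_into J f i \<in> J \<and> f (inv_into J f i) = i" if "i \<in> I" for i
    using b that by (metis bij_betw_def f_inv_into_f inv_into_into)
  show ?thesis
  proof (rule coproductI)
    show "P \<in> Ob C" using cop by (rule coproduct_Ob)
    show "\<iota> (f j) \<in> Hom C (X (f j)) P" if "j \<in> J" for j using coproduct_hom[OF cop fj[OF that]] .
    fix Y k assume Y: "Y \<in> Ob C" and k: "\<And>j. j \<in> J \<Longrightarrow> k j \<in> Hom C (X (f j)) Y"
    have "k (inv_into J f i) \<in> Hom C (X i) Y" if "i \<in> I" for i
      using k[of "inv_into J f i"] g[OF that] by simp
    then obtain h where h: "h \<in> Hom C P Y" "\<And>i. i \<in> I \<Longrightarrow> h \<bullet> \<iota> i = k (inv_into J f i)"
      using coproduct_lift[OF cop Y, of "\<lambda>i. k (inv_into J f i)"] by metis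
    have "h \<bullet> \<iota> (f j) = k j" if "j \<in> J" for j
      using h(2)[OF fj[OF that]] b that by (simp add: bij_betw_def)
    then show "\<exists>h\<in>Hom C P Y. \<forall>j\<in>J. h \<bullet> \<iota> (f j) = k j" using h(1) by blast
  next
    fix Y a c assume ac: "a \<in> Hom C P Y" "c \<in> Hom C P Y"
      and e: "\<And>j. j \<in> J \<Longrightarrow> a \<bullet> \<iota> (f j) = c \<bullet> \<iota> (f j)"
    have "a \<bullet> \<iota> i = c \<bullet> \<iota> i" if "i \<in> I" for i
      using e[of "inv_into J f i"] g[OF that] by simp
    then show "a = c" using coproduct_eq[OF cop ac] by blast
  qed
qed

end

section \<open>Triangulated categories\<close>

context triangulated_category
begin

section \<open>The shift as an additive equivalence\<close>

lemma sh_Ob: "A \<in> Ob T \<Longrightarrow> ShO T A \<in> Ob T"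
  using shift_equivalence by (simp add: is_equivalence_def is_functor_def)

lemma sh_hom: "f \<in> Hom T A B \<Longrightarrow> ShA T f \<in> Hom T (ShO T A) (ShO T B)"
  using shift_equivalence by (simp add: is_equivalence_def is_functor_def)

lemma sh_Ide: "A \<in> Ob T \<Longrightarrow> ShA T (Ide T A) = Ide T (ShO T A)"
  using shift_equivalence by (simp add: is_equivalence_def is_functor_def)

lemma sh_cmp: "f \<in> Hom T A B \<Longrightarrow> g \<in> Hom T B D \<Longrightarrow> ShA T (g \<bullet> f) = ShA T g \<bullet> ShA T f"
  using shift_equivalence by (simp add: is_equivalence_def is_functor_def)

lemma sh_bij: "A \<in> Ob T \<Longrightarrow> B \<in> Ob T
    \<Longrightarrow> bij_betw (ShA T) (Hom T A B) (Hom T (ShO T A) (ShO T B))"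
  using shift_equivalence by (simp add: is_equivalence_def)

lemma sh_faithful:
  assumes "f \<in> Hom T A B" "g \<in> Hom T A B" "ShA T f = ShA T g" shows "f = g"
  using sh_bij[OF Hom_Ob[OF assms(1)]] assms by (auto simp: bij_betw_def inj_on_def)

lemma sh_full:
  assumes "f \<in> Hom T (ShO T A) (ShO T B)" "A \<in> Ob T" "B \<in> Ob T"
  obtains k where "k \<in> Hom T A B" "ShA T k = f"
proof -
  have "f \<in> ShA T ` Hom T A B" using sh_bij[OF assms(2,3)] assms(1) by (simp add: bij_betw_def)
  then show ?thesis using that by blast
qed

lemma sh_essentially_surjective:
  assumes "E \<in> Ob T" obtains A where "A \<in> Ob T" "isomorphic T (ShO T A) E"
proof -
  have "\<forall>E\<in>Ob T. \<exists>A\<in>Ob T. isomorphic T (ShO T A) E"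
    using shift_equivalence by (simp add: is_equivalence_def)
  then show ?thesis using assms that by blast
qed

lemma sh_zer:
  assumes "A \<in> Ob T" "B \<in> Ob T" shows "ShA T (Zer T A B) = Zer T (ShO T A) (ShO T B)"
proof (rule add_idem_zer)
  have z: "Zer T A B \<in> Hom T A B" using assms zer_hom by blast
  show "ShA T (Zer T A B) \<in> Hom T (ShO T A) (ShO T B)" using sh_hom[OF z] .
  show "ShA T (Zer T A B) \<boxplus> ShA T (Zer T A B) = ShA T (Zer T A B)"
    using shift_additive[OF z z] add_zer[OF z] by simp
qed

lemma sh_neg:
  assumes f: "f \<in> Hom T A B" shows "ShA T (Neg T f) = Neg T (ShA T f)"
proof (rule neg_unique[OF sh_hom[OF f] sh_hom[OF neg_hom[OF f]]])
  show "ShA T f \<boxplus> ShA T (Neg T f) = Zer T (ShO T A) (ShO T B)"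
    using shift_additive[OF f neg_hom[OF f]] add_neg[OF f] sh_zer[OF Hom_Ob[OF f]] by simp
qed

lemma sh_zero_object:
  assumes Z: "zero_object T Z" shows "zero_object T (ShO T Z)"
proof (rule zero_object_if_Ide_zer)
  have Zo: "Z \<in> Ob T" using Z by (simp add: zero_object_def)
  show "ShO T Z \<in> Ob T" using sh_Ob[OF Zo] .
  have "Ide T Z = Zer T Z Z" using zero_object_hom_into[OF Z Ide_Hom[OF Zo]] .
  then show "Ide T (ShO T Z) = Zer T (ShO T Z) (ShO T Z)"
    using sh_Ide[OF Zo] sh_zer[OF Zo Zo] by simp
qed

section \<open>Triangles and exactness of Hom\<close>

text \<open>\<open>Tri\<close> mentions arrows only; carrying the three objects along supplies the
  typing facts that exactness and filling arguments use at each step.\<close>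

definition triangle :: "'a \<Rightarrow> 'a \<Rightarrow> 'a \<Rightarrow> 'b \<Rightarrow> 'b \<Rightarrow> 'b \<Rightarrow> bool" where
  "triangle A B D f g h \<longleftrightarrow>
    f \<in> Hom T A B \<and> g \<in> Hom T B D \<and> h \<in> Hom T D (ShO T A) \<and> Tri T f g h"

lemma triangleD:
  assumes "triangle A B D f g h"
  shows "f \<in> Hom T A B" "g \<in> Hom T B D" "h \<in> Hom T D (ShO T A)" "Tri T f g h"
  using assms by (auto simp: triangle_def)

lemma triangle_ex:
  assumes f: "f \<in> Hom T A B" obtains D g h where "triangle A B D f g h"
proof -
  have "f \<in> Ar T" using f by (simp add: Hom_def)
  then obtain g h where t: "Tri T f g h" using ex_Tri by blast
  obtain A' B' D where "f \<in> Hom T A' B'" "g \<in> Hom T B' D" "h \<in> Hom T D (ShO T A')"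
    using Tri_Hom[OF t] by blast
  moreover have "A' = A" "B' = B" using f calculation by (auto simp: Hom_def)
  ultimately show ?thesis using that[of D g h] t by (simp add: triangle_def)
qed

lemma triangle_rotate:
  assumes "triangle A B D f g h"
  shows "triangle B D (ShO T A) g h (Neg T (ShA T f))"
  using assms Tri_rotate[of f A B g D h] neg_hom sh_hom by (simp add: triangle_def)

lemma triangle_morphism:
  assumes t: "triangle A B D f g h" "triangle A' B' D' f' g' h'"
    and ab: "a \<in> Hom T A A'" "b \<in> Hom T B B'" "b \<bullet> f = f' \<bullet> a"
  obtains d where "d \<in> Hom T D D'" "d \<bullet> g = g' \<bullet> b" "ShA T a \<bullet> h = h' \<bullet> d"
proof -
  have 1: "Dom T f = A" "Cod T f = B" "Cod T g = D" "Dom T f' = A'" "Cod T f' = B'" "Cod T g' = D'"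
    using t by (auto simp: triangle_def Hom_def)
  show ?thesis
    using Tri_morphism[of f g h f' g' h' a b, unfolded 1, OF triangleD(4)[OF t(1)] triangleD(4)[OF t(2)] ab]
      that by blast
qed

lemma triangle_Ide:
  assumes "A \<in> Ob T" "zero_object T Z"
  shows "triangle A A Z (Ide T A) (Zer T A Z) (Zer T Z (ShO T A))"
  using assms Ide_Hom zer_hom sh_Ob Tri_Ide by (simp add: triangle_def zero_object_def)

text \<open>The identity triangle of \<open>Y\<close>, completed by the zero object
  \<open>ShO T Z\<close>, is the rotation of this one, so the rotation axiom is read
  backwards.\<close>

lemma triangle_Ide_right:
  assumes Y: "Y \<in> Ob T" and Z: "zero_object T Z"
  shows "triangle Z Y Y (Zer T Z Y) (Ide T Y) (Zer T Y (ShO T Z))"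
proof -
  have Zo: "Z \<in> Ob T" using Z by (simp add: zero_object_def)
  note z = zer_hom[OF Zo Y] Ide_Hom[OF Y] zer_hom[OF Y sh_Ob[OF Zo]]
  have n: "Neg T (ShA T (Zer T Z Y)) = Zer T (ShO T Z) (ShO T Y)"
    using zero_object_hom_from[OF sh_zero_object[OF Z] neg_hom[OF sh_hom[OF z(1)]]] .
  have "Tri T (Ide T Y) (Zer T Y (ShO T Z)) (Zer T (ShO T Z) (ShO T Y))"
    using triangle_Ide[OF Y sh_zero_object[OF Z]] by (simp add: triangle_def)
  then show ?thesis using Tri_rotate[OF z] z n by (simp add: triangle_def)
qed

text \<open>Map the identity triangle of \<open>A\<close> to the given one. The filler starts at a
  zero object, and \<open>g \<bullet> f\<close> factors through it.\<close>

lemma triangle_cmp_zer: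
  assumes t: "triangle A B D f g h" shows "g \<bullet> f = Zer T A D"
proof -
  note h = triangleD[OF t]
  obtain Z where Z: "zero_object T Z" using ex_zero_object by blast
  have A: "A \<in> Ob T" and D: "D \<in> Ob T" using Hom_Ob h by blast+
  obtain d where "d \<in> Hom T Z D" "d \<bullet> Zer T A Z = g \<bullet> f"
    using triangle_morphism[OF triangle_Ide[OF A Z] t Ide_Hom[OF A] h(1)] by metis
  then show ?thesis using cmp_zer[of d Z D A] A by simp
qed

text \<open>Two rotations bring \<open>Neg T (ShA T f)\<close> next to \<open>h\<close>; the sign is
  then removed.\<close>

lemma triangle_cmp_zer3:
  assumes t: "triangle A B D f g h" shows "ShA T f \<bullet> h = Zer T D (ShO T B)"
proof -
  note h = triangleD[OF t]
  note s = sh_hom[OF h(1)]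
  have "Neg T (ShA T f \<bullet> h) = Zer T D (ShO T B)"
    using triangle_cmp_zer[OF triangle_rotate[OF triangle_rotate[OF t]]] neg_cmp[OF h(3) s] by simp
  then show ?thesis
    using neg_neg[OF Cmp_Hom[OF h(3) s]] neg_zer[OF Hom_Ob(1)[OF h(3)] Hom_Ob(2)[OF s]] by simp
qed

text \<open>The axiom fills in only the third map of a morphism of triangles. Comparing the rotated
  identity triangle of \<open>K\<close> with the rotated given one puts the wanted map in that
  position, as a map between shifts, and fullness of the shift brings it back.\<close>

lemma triangle_exact:
  assumes t: "triangle A B D f g h" and x: "x \<in> Hom T K B" and gx: "g \<bullet> x = Zer T K D"
  obtains y where "y \<in> Hom T K A" "x = f \<bullet> y"
proof -
  note h = triangleD[OF t]
  obtain Z where Z: "zero_object T Z" using ex_zero_object by blast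
  have K: "K \<in> Ob T" and A: "A \<in> Ob T" and D: "D \<in> Ob T" using Hom_Ob h x by blast+
  have Zo: "Z \<in> Ob T" using Z by (simp add: zero_object_def)
  note sh = sh_hom[OF h(1)]
  have e: "Zer T Z D \<bullet> Zer T K Z = g \<bullet> x"
    using gx zer_cmp[OF zer_hom[OF K Zo] D] by simp
  obtain d where d: "d \<in> Hom T (ShO T K) (ShO T A)"
    "ShA T x \<bullet> Neg T (ShA T (Ide T K)) = Neg T (ShA T f) \<bullet> d"
    using triangle_morphism[OF triangle_rotate[OF triangle_Ide[OF K Z]] triangle_rotate[OF t] x
        zer_hom[OF Zo D] e] by metis
  obtain y where y: "y \<in> Hom T K A" "ShA T y = d" using sh_full[OF d(1) K A] by metis
  have "ShA T x \<bullet> ShA T (Ide T K) = ShA T x"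
    using sh_cmp[OF Ide_Hom[OF K] x] Cmp_Ide[OF x] by simp
  then have "Neg T (ShA T x) = Neg T (ShA T f \<bullet> d)"
    using d(2) cmp_neg[OF sh_hom[OF Ide_Hom[OF K]] sh_hom[OF x]] neg_cmp[OF d(1) sh] by simp
  then have "ShA T x = ShA T f \<bullet> d"
    using neg_neg[OF sh_hom[OF x]] neg_neg[OF Cmp_Hom[OF d(1) sh]] by metis
  then have "ShA T x = ShA T (f \<bullet> y)" using sh_cmp[OF y(1) h(1)] y(2) by simp
  then have "x = f \<bullet> y" using sh_faithful[OF x Cmp_Hom[OF y(1) h(1)]] by simp
  then show ?thesis using that y(1) by blast
qed

lemma triangle_exact2:
  assumes t: "triangle A B D f g h" and x: "x \<in> Hom T K D" and hx: "h \<bullet> x = Zer T K (ShO T A)"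
  obtains y where "y \<in> Hom T K B" "x = g \<bullet> y"
  using triangle_exact[OF triangle_rotate[OF t] x hx] by metis

lemma triangle_exact3:
  assumes t: "triangle A B D f g h" and x: "x \<in> Hom T K (ShO T A)"
    and fx: "ShA T f \<bullet> x = Zer T K (ShO T B)"
  obtains y where "y \<in> Hom T K D" "x = h \<bullet> y"
proof -
  note h = triangleD[OF t]
  have "Neg T (ShA T f) \<bullet> x = Zer T K (ShO T B)"
    using neg_cmp[OF x sh_hom[OF h(1)]] fx neg_zer[OF Hom_Ob(1)[OF x] sh_Ob[OF Hom_Ob(2)[OF h(1)]]]
    by simp
  then show ?thesis using triangle_exact[OF triangle_rotate[OF triangle_rotate[OF t]] x] that by metis
qed

text \<open>Mapping into the triangle \<open>Z \<rightarrow> Y \<rightarrow> Y\<close> makes the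
  filler itself the factor of \<open>x\<close>.\<close>

lemma triangle_coexact:
  assumes t: "triangle A B D f g h" and x: "x \<in> Hom T B Y" and xf: "x \<bullet> f = Zer T A Y"
  obtains y where "y \<in> Hom T D Y" "x = y \<bullet> g"
proof -
  note h = triangleD[OF t]
  obtain Z where Z: "zero_object T Z" using ex_zero_object by blast
  have Y: "Y \<in> Ob T" and A: "A \<in> Ob T" using Hom_Ob h x by blast+
  have Zo: "Z \<in> Ob T" using Z by (simp add: zero_object_def)
  have e: "x \<bullet> f = Zer T Z Y \<bullet> Zer T A Z"
    using xf cmp_zer[OF zer_hom[OF Zo Y] A] by simp
  obtain d where d: "d \<in> Hom T D Y" "d \<bullet> g = Ide T Y \<bullet> x"
    using triangle_morphism[OF t triangle_Ide_right[OF Y Z] zer_hom[OF A Zo] x e] by metis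
  then show ?thesis using that Ide_Cmp[OF x] by simp
qed

lemma triangle_coexact2:
  assumes t: "triangle A B D f g h" and x: "x \<in> Hom T D Y" and xg: "x \<bullet> g = Zer T B Y"
  obtains y where "y \<in> Hom T (ShO T A) Y" "x = y \<bullet> h"
  using triangle_coexact[OF triangle_rotate[OF t] x xg] by metis

lemma triangle_coexact3:
  assumes t: "triangle A B D f g h" and x: "x \<in> Hom T (ShO T A) Y" and xh: "x \<bullet> h = Zer T D Y"
  obtains y where "y \<in> Hom T (ShO T B) Y" "x = y \<bullet> ShA T f"
proof -
  note h = triangleD[OF t]
  note s = sh_hom[OF h(1)]
  obtain y where y: "y \<in> Hom T (ShO T B) Y" "x = y \<bullet> Neg T (ShA T f)"
    using triangle_coexact[OF triangle_rotate[OF triangle_rotate[OF t]] x xh] by metis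
  have "x = Neg T y \<bullet> ShA T f" using y(2) cmp_neg[OF s y(1)] neg_cmp[OF s y(1)] by simp
  then show ?thesis using that neg_hom[OF y(1)] by blast
qed

text \<open>Three rotations shift the triangle but negate all three maps. The isomorphism that is
  \<open>-1\<close> on the middle object and the identity elsewhere removes the first two signs; the
  third stays.\<close>

lemma triangle_shift:
  assumes t: "triangle A B D f g h"
  shows "triangle (ShO T A) (ShO T B) (ShO T D) (ShA T f) (ShA T g) (Neg T (ShA T h))"
proof -
  note h = triangleD[OF t]
  note s = sh_hom[OF h(1)] sh_hom[OF h(2)] sh_hom[OF h(3)]
  note n = neg_hom[OF s(1)] neg_hom[OF s(2)] neg_hom[OF s(3)]
  have r: "Tri T (Neg T (ShA T f)) (Neg T (ShA T g)) (Neg T (ShA T h))"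
    using triangle_rotate[OF triangle_rotate[OF triangle_rotate[OF t]]] by (simp add: triangle_def)
  have A: "ShO T A \<in> Ob T" and B: "ShO T B \<in> Ob T" and D: "ShO T D \<in> Ob T"
    using Hom_Ob s by blast+
  note i = Ide_Hom[OF B]
  have m: "Neg T (Ide T (ShO T B)) \<bullet> Neg T (Ide T (ShO T B)) = Ide T (ShO T B)"
    using neg_cmp[OF neg_hom[OF i] i] Ide_Cmp[OF neg_hom[OF i]] neg_neg[OF i] by simp
  have iso: "is_iso_arrow T (ShO T B) (ShO T B) (Neg T (Ide T (ShO T B)))"
    using iso_arrowI[OF neg_hom[OF i] neg_hom[OF i] neg_hom[OF i] m m] .
  have "Tri T (ShA T f) (ShA T g) (Neg T (ShA T h))"
  proof (rule Tri_iso[OF r n s(1,2) n(3) iso_arrow_Ide[OF A] iso iso_arrow_Ide[OF D]])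
    show "Neg T (Ide T (ShO T B)) \<bullet> Neg T (ShA T f) = ShA T f \<bullet> Ide T (ShO T A)"
      using neg_cmp[OF n(1) i] Ide_Cmp[OF n(1)] neg_neg[OF s(1)] Cmp_Ide[OF s(1)] by simp
    show "Ide T (ShO T D) \<bullet> Neg T (ShA T g) = ShA T g \<bullet> Neg T (Ide T (ShO T B))"
      using Ide_Cmp[OF n(2)] cmp_neg[OF i s(2)] Cmp_Ide[OF s(2)] by simp
    show "ShA T (Ide T (ShO T A)) \<bullet> Neg T (ShA T h) = Neg T (ShA T h) \<bullet> Ide T (ShO T D)"
      using sh_Ide[OF A] Ide_Cmp[OF n(3)] Cmp_Ide[OF n(3)] by simp
  qed
  then show ?thesis using s n by (simp add: triangle_def)
qed

text \<open>With \<open>g\<close> and \<open>h\<close> zero, exactness lifts the identity of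
  \<open>B\<close> through \<open>f\<close>, and coexactness extends the identity of
  \<open>ShO T A\<close> along \<open>ShA T f\<close>; the extension descends because the shift is
  fully faithful.\<close>

lemma triangle_zero_cone_iso:
  assumes t: "triangle A B D f g h" and D: "zero_object T D"
  shows "is_iso_arrow T A B f"
proof -
  note h = triangleD[OF t]
  have A: "A \<in> Ob T" and B: "B \<in> Ob T" and Do: "D \<in> Ob T" using Hom_Ob h by blast+
  have g: "g = Zer T B D" using zero_object_hom_into[OF D h(2)] .
  have h0: "h = Zer T D (ShO T A)" using zero_object_hom_from[OF D h(3)] .
  obtain r where r: "r \<in> Hom T B A" "Ide T B = f \<bullet> r"
    using triangle_exact[OF t Ide_Hom[OF B]] g Cmp_Ide[OF h(2)] by metis
  note sA = sh_Ob[OF A]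
  have "Ide T (ShO T A) \<bullet> h = Zer T D (ShO T A)" using Ide_Cmp[OF h(3)] h0 by simp
  then obtain l' where l': "l' \<in> Hom T (ShO T B) (ShO T A)" "Ide T (ShO T A) = l' \<bullet> ShA T f"
    using triangle_coexact3[OF t Ide_Hom[OF sA]] by metis
  obtain l where l: "l \<in> Hom T B A" "ShA T l = l'" using sh_full[OF l'(1) B A] by metis
  have "ShA T (l \<bullet> f) = ShA T (Ide T A)" using sh_cmp[OF h(1) l(1)] l'(2) l(2) sh_Ide[OF A] by simp
  then have "l \<bullet> f = Ide T A" using sh_faithful[OF Cmp_Hom[OF h(1) l(1)] Ide_Hom[OF A]] by simp
  then show ?thesis using iso_arrowI[OF h(1) l(1) r(1)] r(2) by simp
qed

text \<open>\<open>is_hocolim\<close> fixes a particular cone object; this moves it along an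
  isomorphism.\<close>

lemma triangle_replace_cone:
  assumes t: "triangle A B D f g h" and d: "is_iso_arrow T D E d"
  obtains h' where "triangle A B E f (d \<bullet> g) h'"
proof -
  note h = triangleD[OF t]
  have A: "A \<in> Ob T" and B: "B \<in> Ob T" using Hom_Ob h by blast+
  obtain e where e: "e \<in> Hom T E D" "e \<bullet> d = Ide T D" "d \<bullet> e = Ide T E"
    using d iso_arrow_inverse by metis
  have dh: "d \<in> Hom T D E" using d by (simp add: is_iso_arrow_def)
  have gE: "d \<bullet> g \<in> Hom T B E" and hE: "h \<bullet> e \<in> Hom T E (ShO T A)"
    using Cmp_Hom h dh e by blast+
  have "Tri T f (d \<bullet> g) (h \<bullet> e)"
  proof (rule Tri_iso[OF h(4) h(1-3) h(1) gE hE iso_arrow_Ide[OF A] iso_arrow_Ide[OF B] d])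
    show "Ide T B \<bullet> f = f \<bullet> Ide T A" using Ide_Cmp[OF h(1)] Cmp_Ide[OF h(1)] by simp
    show "d \<bullet> g = (d \<bullet> g) \<bullet> Ide T B" using Cmp_Ide[OF gE] by simp
    show "ShA T (Ide T A) \<bullet> h = (h \<bullet> e) \<bullet> d"
      using sh_Ide[OF A] Ide_Cmp[OF h(3)] Cmp_assoc[OF dh e(1) h(3)] e(2) Cmp_Ide[OF h(3)] by simp
  qed
  then show ?thesis using that[of "h \<bullet> e"] h(1) gE hE by (simp add: triangle_def)
qed

lemma sh_coproduct:
  assumes cop: "is_coproduct T I X P \<iota>"
  shows "is_coproduct T I (\<lambda>i. ShO T (X i)) (ShO T P) (\<lambda>i. ShA T (\<iota> i))"
proof (rule coproductI)
  have P: "P \<in> Ob T" using coproduct_Ob[OF cop] by blast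
  show "ShO T P \<in> Ob T" using sh_Ob[OF P] .
  note io = coproduct_hom[OF cop]
  show "ShA T (\<iota> i) \<in> Hom T (ShO T (X i)) (ShO T P)" if "i \<in> I" for i using sh_hom[OF io[OF that]] .
  \<comment> \<open>The shift reaches every object only up to isomorphism. Of that isomorphism the
    equation \<open>a \<bullet> b = Ide T Y\<close> carries both existence and uniqueness from
    \<open>W\<close> to \<open>Y\<close>.\<close>
  have red: "\<exists>W a b. W \<in> Ob T \<and> a \<in> Hom T (ShO T W) Y \<and> b \<in> Hom T Y (ShO T W)
      \<and> a \<bullet> b = Ide T Y" if Y: "Y \<in> Ob T" for Y
  proof -
    obtain W where "W \<in> Ob T" "isomorphic T (ShO T W) Y"
      using sh_essentially_surjective[OF Y] by metis
    then show ?thesis unfolding isomorphic_def is_iso_arrow_def by blast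
  qed
  {
    fix Y f assume Y: "Y \<in> Ob T" and f: "\<And>i. i \<in> I \<Longrightarrow> f i \<in> Hom T (ShO T (X i)) Y"
    obtain W a b where W: "W \<in> Ob T" and a: "a \<in> Hom T (ShO T W) Y" and b: "b \<in> Hom T Y (ShO T W)"
      and ab: "a \<bullet> b = Ide T Y" using red[OF Y] by blast
    have "\<exists>k. k \<in> Hom T (X i) W \<and> ShA T k = b \<bullet> f i" if "i \<in> I" for i
      using sh_full[OF Cmp_Hom[OF f[OF that] b] coproduct_Ob(2)[OF cop that] W] by metis
    then obtain k where k: "\<And>i. i \<in> I \<Longrightarrow> k i \<in> Hom T (X i) W \<and> ShA T (k i) = b \<bullet> f i"
      by metis
    obtain m where m: "m \<in> Hom T P W" "\<And>i. i \<in> I \<Longrightarrow> m \<bullet> \<iota> i = k i"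
      using coproduct_lift[of I X P \<iota> W k, OF cop W] k by metis
    have "(a \<bullet> ShA T m) \<bullet> ShA T (\<iota> i) = f i" if i: "i \<in> I" for i
    proof -
      have "(a \<bullet> ShA T m) \<bullet> ShA T (\<iota> i) = a \<bullet> (b \<bullet> f i)"
        using Cmp_assoc[OF sh_hom[OF io[OF i]] sh_hom[OF m(1)] a] sh_cmp[OF io[OF i] m(1)] m(2)[OF i]
          k[OF i] by simp
      also have "\<dots> = f i" using Cmp_assoc[OF f[OF i] b a] ab Ide_Cmp[OF f[OF i]] by simp
      finally show ?thesis .
    qed
    then show "\<exists>h\<in>Hom T (ShO T P) Y. \<forall>i\<in>I. h \<bullet> ShA T (\<iota> i) = f i"
      using Cmp_Hom[OF sh_hom[OF m(1)] a] by blast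
  next
    fix Y u v assume u: "u \<in> Hom T (ShO T P) Y" and v: "v \<in> Hom T (ShO T P) Y"
      and uv: "\<And>i. i \<in> I \<Longrightarrow> u \<bullet> ShA T (\<iota> i) = v \<bullet> ShA T (\<iota> i)"
    obtain W a b where W: "W \<in> Ob T" and a: "a \<in> Hom T (ShO T W) Y" and b: "b \<in> Hom T Y (ShO T W)"
      and ab: "a \<bullet> b = Ide T Y" using red[OF Hom_Ob(2)[OF u]] by blast
    obtain p where p: "p \<in> Hom T P W" "ShA T p = b \<bullet> u" using sh_full[OF Cmp_Hom[OF u b] P W] by metis
    obtain q where q: "q \<in> Hom T P W" "ShA T q = b \<bullet> v" using sh_full[OF Cmp_Hom[OF v b] P W] by metis
    have "p = q"
    proof (rule coproduct_eq[OF cop p(1) q(1)])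
      fix i assume i: "i \<in> I"
      note s = sh_hom[OF io[OF i]]
      have "ShA T (p \<bullet> \<iota> i) = ShA T (q \<bullet> \<iota> i)"
        using sh_cmp[OF io[OF i] p(1)] sh_cmp[OF io[OF i] q(1)] p(2) q(2) uv[OF i]
          Cmp_assoc[OF s u b] Cmp_assoc[OF s v b] by simp
      then show "p \<bullet> \<iota> i = q \<bullet> \<iota> i"
        using sh_faithful[OF Cmp_Hom[OF io[OF i] p(1)] Cmp_Hom[OF io[OF i] q(1)]] by simp
    qed
    then have "a \<bullet> (b \<bullet> u) = a \<bullet> (b \<bullet> v)" using p q by simp
    then show "u = v" using Cmp_assoc[OF u b a] Cmp_assoc[OF v b a] ab Ide_Cmp[OF u] Ide_Cmp[OF v] by simp
  }
qed

end

section \<open>Telescopes and homotopy colimits\<close>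

text \<open>Lets a property of maps pass to finite sums. For an infinite \<open>A\<close> the
  product has the default value \<open>\<one>\<close>, which the first assumption covers.\<close>

lemma (in comm_monoid) finprod_closed_under:
  assumes "Q \<one>" "\<And>x y. \<lbrakk>x \<in> carrier G; y \<in> carrier G; Q x; Q y\<rbrakk> \<Longrightarrow> Q (x \<otimes> y)"
    and "\<And>i. i \<in> A \<Longrightarrow> f i \<in> carrier G \<and> Q (f i)"
  shows "Q (finprod G f A)"
  using assms(3)
proof (induction A rule: infinite_finite_induct)
  case (insert a A)
  then have "finprod G f (insert a A) = f a \<otimes> finprod G f A"
    by (intro finprod_insert) auto
  moreover have "finprod G f A \<in> carrier G" using insert by (intro finprod_closed) auto
  ultimately show ?case using insert assms(2) by simp
qed (use assms in simp_all)

section \<open>Transition maps of a sequence\<close>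

text \<open>The identity is the right value at \<open>m = n\<close> and a mere default for
  \<open>m < n\<close>.\<close>

primrec path :: "('o, 'm, 'z) precat_scheme \<Rightarrow> (nat \<Rightarrow> 'o) \<Rightarrow> (nat \<Rightarrow> 'm) \<Rightarrow> nat \<Rightarrow> nat \<Rightarrow> 'm" where
  "path C A \<phi> n 0 = Ide C (A n)"
| "path C A \<phi> n (Suc m) = (if n \<le> m then \<phi> m \<bullet>\<^bsub>C\<^esub> path C A \<phi> n m else Ide C (A n))"

context category
begin

lemma path_refl: "path C A \<phi> n n = Ide C (A n)"
  by (cases n) auto

lemma path_hom:
  assumes s: "is_sequence C A \<phi>" and "n \<le> m"
  shows "path C A \<phi> n m \<in> Hom C (A n) (A m)"
  using assms(2)
proof (induction m rule: dec_induct)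
  case base
  then show ?case using s Ide_Hom by (simp add: path_refl is_sequence_def)
next
  case (step m)
  then show ?case using s Cmp_Hom[OF step.IH, of "\<phi> m" "A (Suc m)"] by (simp add: is_sequence_def)
qed

lemma path_trans:
  assumes s: "is_sequence C A \<phi>" and nm: "n \<le> m" and "m \<le> l"
  shows "path C A \<phi> m l \<bullet> path C A \<phi> n m = path C A \<phi> n l"
  using assms(3)
proof (induction l rule: dec_induct)
  case base
  then show ?case using Ide_Cmp[OF path_hom[OF s nm]] by (simp add: path_refl)
next
  case (step l)
  have p: "\<phi> l \<in> Hom C (A l) (A (Suc l))" using s by (simp add: is_sequence_def)
  show ?case
    using step nm Cmp_assoc[OF path_hom[OF s nm] path_hom[OF s step.hyps(1)] p] by simp
qed

lemma path_step:
  assumes "is_sequence C A \<phi>" shows "path C A \<phi> n (Suc n) = \<phi> n"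
  using assms Cmp_Ide[of "\<phi> n" "A n" "A (Suc n)"] by (simp add: path_refl is_sequence_def)

lemma path_Suc_left:
  assumes s: "is_sequence C A \<phi>" and "n < m"
  shows "path C A \<phi> n m = path C A \<phi> (Suc n) m \<bullet> \<phi> n"
  using path_trans[OF s, of n "Suc n" m] path_step[OF s, of n] assms(2) by simp

lemma path_subsequence:
  assumes s: "is_sequence C A \<phi>" and r: "strict_mono r" and "k \<le> l"
  shows "path C (\<lambda>k. A (r k)) (\<lambda>k. path C A \<phi> (r k) (r (Suc k))) k l = path C A \<phi> (r k) (r l)"
  using assms(3)
proof (induction l rule: dec_induct)
  case base
  then show ?case by (simp add: path_refl)
next
  case (step l)
  have "r k \<le> r l" "r l \<le> r (Suc l)" using r step.hyps(1) by (simp_all add: strict_mono_less_eq)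
  then show ?case using step path_trans[OF s, of "r k" "r l" "r (Suc l)"] by simp
qed

lemma subsequence:
  assumes s: "is_sequence C A \<phi>" and r: "strict_mono r"
  shows "is_sequence C (\<lambda>k. A (r k)) (\<lambda>k. path C A \<phi> (r k) (r (Suc k)))"
proof -
  have "r k \<le> r (Suc k)" for k using r by (simp add: strict_mono_less_eq)
  then show ?thesis using path_hom[OF s] s by (simp add: is_sequence_def)
qed

end

context triangulated_category
begin

lemma sh_sequence:
  "is_sequence T A \<phi> \<Longrightarrow> is_sequence T (\<lambda>n. ShO T (A n)) (\<lambda>n. ShA T (\<phi> n))"
  using sh_Ob sh_hom by (simp add: is_sequence_def)

lemma sh_path:
  assumes s: "is_sequence T A \<phi>" and "n \<le> m"
  shows "path T (\<lambda>n. ShO T (A n)) (\<lambda>n. ShA T (\<phi> n)) n m = ShA T (path T A \<phi> n m)"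
  using assms(2)
proof (induction m rule: dec_induct)
  case base
  then show ?case using s sh_Ide by (simp add: path_refl is_sequence_def)
next
  case (step m)
  have p: "\<phi> m \<in> Hom T (A m) (A (Suc m))" using s by (simp add: is_sequence_def)
  show ?case using step sh_cmp[OF path_hom[OF s step.hyps(1)] p] by simp
qed

section \<open>The telescope map\<close>

text \<open>Separates \<open>\<Phi>\<close> from its cone: the results on maps into \<open>P\<close>
  concern \<open>\<Phi>\<close> alone, and they are applied to its shift as well.\<close>

definition telescope where
  "telescope A \<phi> P \<iota> \<Phi> \<longleftrightarrow> is_sequence T A \<phi> \<and> is_coproduct T UNIV A P \<iota> \<and> \<Phi> \<in> Hom T P P \<and>
    (\<forall>i. \<Phi> \<bullet> \<iota> i = \<iota> i \<boxplus> (\<iota> (Suc i) \<bullet> Neg T (\<phi> i)))"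

lemma telescopeD:
  assumes "telescope A \<phi> P \<iota> \<Phi>"
  shows "is_sequence T A \<phi>" "is_coproduct T UNIV A P \<iota>" "\<Phi> \<in> Hom T P P"
    "\<phi> i \<in> Hom T (A i) (A (Suc i))" "\<iota> i \<in> Hom T (A i) P" "A i \<in> Ob T" "P \<in> Ob T"
    "\<Phi> \<bullet> \<iota> i = \<iota> i \<boxplus> Neg T (\<iota> (Suc i) \<bullet> \<phi> i)"
proof -
  show *: "is_sequence T A \<phi>" "is_coproduct T UNIV A P \<iota>" "\<Phi> \<in> Hom T P P"
    using assms by (auto simp: telescope_def)
  show p: "\<phi> i \<in> Hom T (A i) (A (Suc i))" for i using *(1) by (simp add: is_sequence_def)
  show io: "\<iota> i \<in> Hom T (A i) P" for i using coproduct_hom[OF *(2)] by simp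
  show "A i \<in> Ob T" "P \<in> Ob T" using Hom_Ob[OF io] by blast+
  show "\<Phi> \<bullet> \<iota> i = \<iota> i \<boxplus> Neg T (\<iota> (Suc i) \<bullet> \<phi> i)"
    using assms cmp_neg[OF p io] by (simp add: telescope_def)
qed

lemma is_hocolim_iff:
  "is_hocolim T A \<phi> X \<longleftrightarrow> (\<exists>P \<iota> \<Phi> g h. telescope A \<phi> P \<iota> \<Phi> \<and> triangle P P X \<Phi> g h)"
  unfolding is_hocolim_def telescope_def triangle_def by blast

lemma telescope_ex:
  assumes s: "is_sequence T A \<phi>" and cop: "is_coproduct T UNIV A P \<iota>"
  obtains \<Phi> where "telescope A \<phi> P \<iota> \<Phi>"
proof -
  have io: "\<iota> i \<in> Hom T (A i) P" for i using coproduct_hom[OF cop] by simp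
  have p: "\<phi> i \<in> Hom T (A i) (A (Suc i))" for i using s by (simp add: is_sequence_def)
  have "\<iota> i \<boxplus> (\<iota> (Suc i) \<bullet> Neg T (\<phi> i)) \<in> Hom T (A i) P" for i
    using add_hom[OF io Cmp_Hom[OF neg_hom[OF p] io]] .
  then obtain \<Phi> where "\<Phi> \<in> Hom T P P" "\<And>i. \<Phi> \<bullet> \<iota> i = \<iota> i \<boxplus> (\<iota> (Suc i) \<bullet> Neg T (\<phi> i))"
    using coproduct_lift[OF cop coproduct_Ob(1)[OF cop],
        of "\<lambda>i. \<iota> i \<boxplus> (\<iota> (Suc i) \<bullet> Neg T (\<phi> i))"] by auto
  then show ?thesis using that[of \<Phi>] s cop by (simp add: telescope_def)
qed

text \<open>A map into the cone is first tested after the connecting map, which lands in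
  \<open>ShO T P\<close>; there \<open>\<Phi>\<close> is replaced by its shift.\<close>

lemma telescope_shift:
  assumes t: "telescope A \<phi> P \<iota> \<Phi>"
  shows "telescope (\<lambda>n. ShO T (A n)) (\<lambda>n. ShA T (\<phi> n)) (ShO T P) (\<lambda>n. ShA T (\<iota> n)) (ShA T \<Phi>)"
proof -
  note d = telescopeD[OF t]
  have "ShA T \<Phi> \<bullet> ShA T (\<iota> i) = ShA T (\<iota> i) \<boxplus> (ShA T (\<iota> (Suc i)) \<bullet> Neg T (ShA T (\<phi> i)))" for i
  proof -
    have "\<iota> (Suc i) \<bullet> \<phi> i \<in> Hom T (A i) P" using Cmp_Hom[OF d(4,5)] .
    then have "ShA T \<Phi> \<bullet> ShA T (\<iota> i) = ShA T (\<iota> i) \<boxplus> Neg T (ShA T (\<iota> (Suc i) \<bullet> \<phi> i))"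
      using sh_cmp[OF d(5,3), of i] d(8)[of i] shift_additive[OF d(5) neg_hom] sh_neg by simp
    then show ?thesis
      using sh_cmp[OF d(4,5)] cmp_neg[OF sh_hom[OF d(4)] sh_hom[OF d(5)]] by simp
  qed
  then show ?thesis
    using sh_sequence[OF d(1)] sh_coproduct[OF d(2)] sh_hom[OF d(3)] by (simp add: telescope_def)
qed

lemma telescope_cone_path:
  assumes t: "telescope A \<phi> P \<iota> \<Phi>" and g: "g \<in> Hom T P X" and z: "g \<bullet> \<Phi> = Zer T P X"
    and "n \<le> m"
  shows "(g \<bullet> \<iota> m) \<bullet> path T A \<phi> n m = g \<bullet> \<iota> n"
  using assms(4)
proof (induction m rule: dec_induct)
  note d = telescopeD[OF t]
  case base
  show ?case using Cmp_Ide[OF Cmp_Hom[OF d(5) g]] by (simp add: path_refl)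
next
  note d = telescopeD[OF t]
  case (step m)
  have gi: "g \<bullet> \<iota> i \<in> Hom T (A i) X" for i using Cmp_Hom[OF d(5) g] .
  have "Zer T (A m) X = g \<bullet> (\<Phi> \<bullet> \<iota> m)"
    using Cmp_assoc[OF d(5,3) g, of m] z zer_cmp[OF d(5) Hom_Ob(2)[OF g]] by simp
  also have "\<dots> = (g \<bullet> \<iota> m) \<boxplus> Neg T ((g \<bullet> \<iota> (Suc m)) \<bullet> \<phi> m)"
    using d(8)[of m] cmp_sub[OF d(5) Cmp_Hom[OF d(4,5)] g] Cmp_assoc[OF d(4,5) g] by simp
  finally have e: "g \<bullet> \<iota> m = (g \<bullet> \<iota> (Suc m)) \<bullet> \<phi> m"
    using sub_eq_zer[OF gi Cmp_Hom[OF d(4) gi]] by simp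
  have "(g \<bullet> \<iota> (Suc m)) \<bullet> path T A \<phi> n (Suc m) = (g \<bullet> \<iota> m) \<bullet> path T A \<phi> n m"
    using step.hyps(1) Cmp_assoc[OF path_hom[OF d(1) step.hyps(1)] d(4) gi] e by simp
  then show ?case using step.IH by simp
qed

text \<open>Formally \<open>\<Phi>\<close> is the identity minus the one-step map, with inverse the
  infinite sum of all transition maps. \<open>\<theta> k\<close> is the component of that inverse at
  stage \<open>k\<close>: it collapses the stages up to \<open>k\<close> along their paths and kills
  the later ones. On stage \<open>i < k\<close> the two terms of
  \<open>\<theta> k \<bullet> \<Phi>\<close> cancel, and at \<open>i = k\<close> the second one is
  zero.\<close>

lemma telescope_projections:
  assumes t: "telescope A \<phi> P \<iota> \<Phi>"
  obtains \<pi> \<theta> where "\<And>k. \<pi> k \<in> Hom T P (A k)"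
    "\<And>k i. \<pi> k \<bullet> \<iota> i = (if i = k then Ide T (A i) else Zer T (A i) (A k))"
    "\<And>k. \<theta> k \<in> Hom T P (A k)" "\<And>k i. i \<le> k \<Longrightarrow> \<theta> k \<bullet> \<iota> i = path T A \<phi> i k"
    "\<And>k. \<theta> k \<bullet> \<Phi> = \<pi> k"
proof -
  note d = telescopeD[OF t]
  have "\<exists>p. p \<in> Hom T P (A k) \<and> (\<forall>i. p \<bullet> \<iota> i = (if i = k then Ide T (A i) else Zer T (A i) (A k)))" for k
    using coproduct_lift[OF d(2) d(6), where f="\<lambda>i. if i = k then Ide T (A i) else Zer T (A i) (A k)"]
      Ide_Hom zer_hom d(6) by (smt (verit) UNIV_I)
  then obtain \<pi> where p: "\<And>k. \<pi> k \<in> Hom T P (A k)"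
    "\<And>k i. \<pi> k \<bullet> \<iota> i = (if i = k then Ide T (A i) else Zer T (A i) (A k))" by metis
  have "\<exists>p. p \<in> Hom T P (A k) \<and> (\<forall>i. p \<bullet> \<iota> i = (if i \<le> k then path T A \<phi> i k else Zer T (A i) (A k)))" for k
    using coproduct_lift[OF d(2) d(6), where f="\<lambda>i. if i \<le> k then path T A \<phi> i k else Zer T (A i) (A k)"]
      path_hom[OF d(1)] zer_hom d(6) by (smt (verit) UNIV_I)
  then obtain \<theta> where th: "\<And>k. \<theta> k \<in> Hom T P (A k)"
    "\<And>k i. \<theta> k \<bullet> \<iota> i = (if i \<le> k then path T A \<phi> i k else Zer T (A i) (A k))" by metis
  have "\<theta> k \<bullet> \<Phi> = \<pi> k" for k
  proof (rule coproduct_eq[OF d(2) Cmp_Hom[OF d(3) th(1)] p(1)])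
    fix i
    have "(\<theta> k \<bullet> \<Phi>) \<bullet> \<iota> i = (\<theta> k \<bullet> \<iota> i) \<boxplus> Neg T ((\<theta> k \<bullet> \<iota> (Suc i)) \<bullet> \<phi> i)"
      using Cmp_assoc[OF d(5,3) th(1)] d(8)[of i] cmp_sub[OF d(5) Cmp_Hom[OF d(4,5)] th(1)]
        Cmp_assoc[OF d(4,5) th(1)] by simp
    also have "\<dots> = \<pi> k \<bullet> \<iota> i"
    proof -
      consider "i < k" | "i = k" | "k < i" by linarith
      then show ?thesis
      proof cases
        case 1
        then have "(\<theta> k \<bullet> \<iota> (Suc i)) \<bullet> \<phi> i = \<theta> k \<bullet> \<iota> i" using th(2) path_Suc_left[OF d(1) 1] by simp
        then show ?thesis using 1 p(2) add_neg[OF Cmp_Hom[OF d(5) th(1)]] by simp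
      next
        case 2
        then show ?thesis
          using th(2) p(2) zer_cmp[OF d(4) d(6)] neg_zer[OF d(6) d(6)] add_zer[OF Ide_Hom[OF d(6)]]
          by (simp add: path_refl)
      next
        case 3
        then show ?thesis
          using th(2) p(2) zer_cmp[OF d(4) d(6)] neg_zer[OF d(6) d(6)] add_zer[OF zer_hom[OF d(6) d(6)]]
          by simp
      qed
    qed
    finally show "(\<theta> k \<bullet> \<Phi>) \<bullet> \<iota> i = \<pi> k \<bullet> \<iota> i" .
  qed
  then show ?thesis using that[of \<pi> \<theta>] p th by simp
qed

end

section \<open>Compact objects and sequences\<close>

context compactly_generated_triangulated_category
begin

section \<open>Countable families inside the universe\<close>

text \<open>Uncountability of \<open>U\<close> enters here: \<open>nat\<close> is strictly smaller
  than \<open>U\<close>, so its copy inside \<open>U\<close> counts as a small index set.\<close>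

lemma nat_embeds_small:
  obtains f :: "nat \<Rightarrow> 'u" where "bij_betw f UNIV (range f)" "range f \<subseteq> U" "small U (range f)"
proof -
  have lt: "|UNIV :: nat set| <o |U|"
    using uncountable_universe card_of_nat ordIso_ordLess_trans by blast
  then have "|UNIV :: nat set| \<le>o |U|" by (rule ordLess_imp_ordLeq)
  then obtain f :: "nat \<Rightarrow> 'u" where f: "inj f" "range f \<subseteq> U" using card_of_ordLeq[of "UNIV :: nat set" U] by metis
  have "|range f| <o |U|" using card_of_image lt ordLeq_ordLess_trans by blast
  then show ?thesis using that[of f] f by (simp add: small_def inj_on_imp_bij_betw)
qed

lemma countable_coproduct_ex:
  assumes X: "\<And>n::nat. X n \<in> Ob T"
  obtains P \<iota> where "is_coproduct T UNIV X P \<iota>"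
proof -
  obtain f :: "nat \<Rightarrow> 'u" where f: "bij_betw f UNIV (range f)" "range f \<subseteq> U" "small U (range f)"
    using nat_embeds_small by blast
  have "\<forall>i\<in>range f. X (inv_into UNIV f i) \<in> Ob T" using X by simp
  then obtain P \<iota> where cop: "is_coproduct T (range f) (\<lambda>i. X (inv_into UNIV f i)) P \<iota>"
    using small_coproducts[unfolded has_small_coproducts_def, rule_format,
        of "range f" "\<lambda>i. X (inv_into UNIV f i)"] f(2,3) by metis
  have "is_coproduct T UNIV X P (\<lambda>n. \<iota> (f n))"
    using coproduct_reindex_back[OF f(1) cop] f(1) by (simp add: bij_betw_def)
  then show ?thesis using that by blast
qed

text \<open>Surjectivity of the canonical map writes \<open>q\<close> as a finite sum of maps
  \<open>\<iota> i \<bullet> z\<close>. Phrased as an induction over such sums, compactness applies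
  to any property that is compatible with addition.\<close>

lemma compact_coproduct_induct:
  assumes K: "K \<in> compact_objects U T" and cop: "is_coproduct T (UNIV :: nat set) X P \<iota>"
    and q: "q \<in> Hom T K P"
    and zer: "Q (Zer T K P)"
    and add: "\<And>x y. \<lbrakk>x \<in> Hom T K P; y \<in> Hom T K P; Q x; Q y\<rbrakk> \<Longrightarrow> Q (x \<boxplus> y)"
    and inc: "\<And>i z. z \<in> Hom T K (X i) \<Longrightarrow> Q (\<iota> i \<bullet> z)"
  shows "Q q"
proof -
  obtain f :: "nat \<Rightarrow> 'u" where f: "bij_betw f UNIV (range f)" "range f \<subseteq> U" "small U (range f)"
    using nat_embeds_small by blast
  define g where "g = inv_into UNIV f"
  have cop': "is_coproduct T (range f) (\<lambda>i. X (g i)) P (\<lambda>i. \<iota> (g i))"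
    unfolding g_def using coproduct_reindex[OF f(1) cop] .
  have Ko: "K \<in> Ob T" using K by (simp add: compact_objects_def)
  have Xo: "X i \<in> Ob T" and Po: "P \<in> Ob T" for i using coproduct_Ob[OF cop] by auto
  let ?G = "hom_group T K P" and ?H = "\<lambda>i. hom_group T K (X (g i))"
  have cK: "\<forall>I X P \<iota>. I \<subseteq> U \<and> small U I \<and> is_coproduct T I X P \<iota> \<longrightarrow>
       (\<lambda>x. gfinprod (hom_group T K P) (\<lambda>i. \<iota> i \<bullet> x i) I)
         \<in> iso (sum_group I (\<lambda>i. hom_group T K (X i))) (hom_group T K P)"
    using K unfolding compact_objects_def by blast
  have "(\<lambda>x. gfinprod ?G (\<lambda>i. \<iota> (g i) \<bullet> x i) (range f)) \<in> iso (sum_group (range f) ?H) ?G"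
    using cK[rule_format, OF conjI[OF f(2) conjI[OF f(3) cop']]] .
  moreover have "q \<in> carrier ?G" using q by (simp add: hom_group_def)
  ultimately obtain x where x: "x \<in> carrier (sum_group (range f) ?H)"
    "q = gfinprod ?G (\<lambda>i. \<iota> (g i) \<bullet> x i) (range f)"
    unfolding iso_def bij_betw_def by blast
  have "group (?H i)" for i using hom_comm_group[OF Ko Xo] by (simp add: comm_group_def)
  then have xi: "x i \<in> Hom T K (X (g i))" if "i \<in> range f" for i
    using x(1) that by (auto simp: carrier_sum_group hom_group_def)
  have cm: "comm_monoid ?G" using hom_comm_group[OF Ko Po] by (simp add: comm_group_def)
  have Q1: "Q \<one>\<^bsub>?G\<^esub>" using zer by (simp add: hom_group_def)
  \<comment> \<open>\<open>gfinprod\<close> is the product over the support of the family, with the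
    unit as default value if the support is infinite; \<open>Q1\<close> covers the default.\<close>
  have "Q (finprod ?G (\<lambda>i. \<iota> (g i) \<bullet> x i) {i \<in> range f. \<iota> (g i) \<bullet> x i \<noteq> \<one>\<^bsub>?G\<^esub>})"
  proof (rule comm_monoid.finprod_closed_under[where Q=Q, OF cm Q1])
    show "Q (x \<otimes>\<^bsub>?G\<^esub> y)" if "x \<in> carrier ?G" "y \<in> carrier ?G" "Q x" "Q y" for x y
      using that add by (simp add: hom_group_def)
    fix i assume "i \<in> {i \<in> range f. \<iota> (g i) \<bullet> x i \<noteq> \<one>\<^bsub>?G\<^esub>}"
    then show "\<iota> (g i) \<bullet> x i \<in> carrier ?G \<and> Q (\<iota> (g i) \<bullet> x i)"
      using xi inc Cmp_Hom[OF xi coproduct_hom[OF cop]] by (simp add: hom_group_def)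
  qed
  then show "Q q" using x(2) Q1 unfolding gfinprod_def by simp
qed

section \<open>Maps from compact objects into a homotopy colimit\<close>

lemma compact_Ob: "K \<in> compact_objects U T \<Longrightarrow> K \<in> Ob T"
  by (simp add: compact_objects_def)

text \<open>A map \<open>\<iota> i \<bullet> z\<close> has its only component at \<open>i\<close>,
  so \<open>Suc i\<close> is a bound for it; a sum takes the larger of two bounds.\<close>

lemma compact_projections_eventually_zero:
  assumes K: "K \<in> compact_objects U T" and t: "telescope A \<phi> P \<iota> \<Phi>" and q: "q \<in> Hom T K P"
    and \<pi>: "\<And>k. \<pi> k \<in> Hom T P (A k)"
      "\<And>k i. \<pi> k \<bullet> \<iota> i = (if i = k then Ide T (A i) else Zer T (A i) (A k))"
  shows "\<exists>N. \<forall>k\<ge>N. \<pi> k \<bullet> q = Zer T K (A k)"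
proof (rule compact_coproduct_induct[OF K telescopeD(2)[OF t] q])
  note d = telescopeD[OF t]
  show "\<exists>N. \<forall>k\<ge>N. \<pi> k \<bullet> Zer T K P = Zer T K (A k)" using cmp_zer[OF \<pi>(1) compact_Ob[OF K]] by simp
  show "\<exists>N. \<forall>k\<ge>N. \<pi> k \<bullet> (x \<boxplus> y) = Zer T K (A k)"
    if x: "x \<in> Hom T K P" and y: "y \<in> Hom T K P" and ex: "\<exists>N. \<forall>k\<ge>N. \<pi> k \<bullet> x = Zer T K (A k)"
      and ey: "\<exists>N. \<forall>k\<ge>N. \<pi> k \<bullet> y = Zer T K (A k)" for x y
  proof -
    obtain N M where "\<forall>k\<ge>N. \<pi> k \<bullet> x = Zer T K (A k)" "\<forall>k\<ge>M. \<pi> k \<bullet> y = Zer T K (A k)"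
      using ex ey by blast
    then have "\<forall>k\<ge>max N M. \<pi> k \<bullet> (x \<boxplus> y) = Zer T K (A k)"
      using Cmp_Add_right[OF x y \<pi>(1)] add_zer[OF zer_hom[OF compact_Ob[OF K] d(6)]] by simp
    then show ?thesis by blast
  qed
  show "\<exists>N. \<forall>k\<ge>N. \<pi> k \<bullet> (\<iota> i \<bullet> z) = Zer T K (A k)" if z: "z \<in> Hom T K (A i)" for i z
  proof -
    have "\<pi> k \<bullet> (\<iota> i \<bullet> z) = Zer T K (A k)" if "k \<ge> Suc i" for k
      using Cmp_assoc[OF z d(5) \<pi>(1), of k, symmetric] \<pi>(2)[of k i] that zer_cmp[OF z d(6)] by simp
    then show ?thesis by blast
  qed
qed

text \<open>The partial sums \<open>e N\<close> of \<open>\<iota> i \<bullet> \<pi> i\<close> eventually fix a map from a compact object.\<close>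

lemma compact_projections_separate:
  assumes K: "K \<in> compact_objects U T" and t: "telescope A \<phi> P \<iota> \<Phi>" and q: "q \<in> Hom T K P"
    and \<pi>: "\<And>k. \<pi> k \<in> Hom T P (A k)"
      "\<And>k i. \<pi> k \<bullet> \<iota> i = (if i = k then Ide T (A i) else Zer T (A i) (A k))"
    and z: "\<And>k. \<pi> k \<bullet> q = Zer T K (A k)"
  shows "q = Zer T K P"
proof -
  note d = telescopeD[OF t]
  note Ko = compact_Ob[OF K]
  define e where "e = rec_nat (Zer T P P) (\<lambda>n p. p \<boxplus> (\<iota> n \<bullet> \<pi> n))"
  have e0: "e 0 = Zer T P P" and eS: "\<And>n. e (Suc n) = e n \<boxplus> (\<iota> n \<bullet> \<pi> n)" by (simp_all add: e_def)
  have ip: "\<iota> n \<bullet> \<pi> n \<in> Hom T P P" for n using Cmp_Hom[OF \<pi>(1) d(5)] .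
  have eh: "e n \<in> Hom T P P" for n
    by (induction n) (use e0 eS zer_hom[OF d(7) d(7)] add_hom[OF _ ip] in simp_all)
  have ei: "e n \<bullet> \<iota> i = (if i < n then \<iota> i else Zer T (A i) P)" for n i
  proof (induction n)
    case 0
    then show ?case using e0 zer_cmp[OF d(5) d(7)] by simp
  next
    case (Suc n)
    have "e (Suc n) \<bullet> \<iota> i = (e n \<bullet> \<iota> i) \<boxplus> (\<iota> n \<bullet> (\<pi> n \<bullet> \<iota> i))"
      using eS Cmp_Add_left[OF d(5) eh ip] Cmp_assoc[OF d(5) \<pi>(1) d(5)] by simp
    then show ?case
      using Suc \<pi>(2)[of n i] Cmp_Ide[OF d(5)] cmp_zer[OF d(5) d(6)] add_zer[OF d(5)]
        zer_add[OF d(5)] add_zer[OF zer_hom[OF d(6) d(7)]] by (auto simp: less_Suc_eq)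
  qed
  have "\<exists>N. \<forall>n\<ge>N. e n \<bullet> q = q"
  proof (rule compact_coproduct_induct[OF K d(2) q])
    show "\<exists>N. \<forall>n\<ge>N. e n \<bullet> Zer T K P = Zer T K P" using cmp_zer[OF eh Ko] by simp
    show "\<exists>N. \<forall>n\<ge>N. e n \<bullet> (x \<boxplus> y) = x \<boxplus> y"
      if x: "x \<in> Hom T K P" and y: "y \<in> Hom T K P" and ex: "\<exists>N. \<forall>n\<ge>N. e n \<bullet> x = x"
        and ey: "\<exists>N. \<forall>n\<ge>N. e n \<bullet> y = y" for x y
    proof -
      obtain N M where "\<forall>n\<ge>N. e n \<bullet> x = x" "\<forall>n\<ge>M. e n \<bullet> y = y" using ex ey by blast
      then have "\<forall>n\<ge>max N M. e n \<bullet> (x \<boxplus> y) = x \<boxplus> y" using Cmp_Add_right[OF x y eh] by simp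
      then show ?thesis by blast
    qed
    show "\<exists>N. \<forall>n\<ge>N. e n \<bullet> (\<iota> i \<bullet> z) = \<iota> i \<bullet> z" if z: "z \<in> Hom T K (A i)" for i z
    proof -
      have "e n \<bullet> (\<iota> i \<bullet> z) = \<iota> i \<bullet> z" if "n \<ge> Suc i" for n
        using Cmp_assoc[OF z d(5) eh, of n, symmetric] ei[of n i] that by simp
      then show ?thesis by blast
    qed
  qed
  moreover have "e n \<bullet> q = Zer T K P" for n
  proof (induction n)
    case 0
    then show ?case using e0 zer_cmp[OF q d(7)] by simp
  next
    case (Suc n)
    have "e (Suc n) \<bullet> q = (e n \<bullet> q) \<boxplus> (\<iota> n \<bullet> (\<pi> n \<bullet> q))"
      using eS Cmp_Add_left[OF q eh ip] Cmp_assoc[OF q \<pi>(1) d(5)] by simp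
    then show ?case using Suc z cmp_zer[OF d(5) Ko] add_zer[OF zer_hom[OF Ko d(7)]] by simp
  qed
  ultimately show ?thesis by auto
qed

text \<open>\<open>\<theta> k\<close> turns \<open>\<Phi> \<bullet> q = 0\<close> into
  \<open>\<pi> k \<bullet> q = 0\<close> for all \<open>k\<close>, and a map from a compact object
  vanishes once all its components do.\<close>

lemma telescope_injective_on_compact:
  assumes K: "K \<in> compact_objects U T" and t: "telescope A \<phi> P \<iota> \<Phi>" and q: "q \<in> Hom T K P"
    and z: "\<Phi> \<bullet> q = Zer T K P"
  shows "q = Zer T K P"
proof -
  note d = telescopeD[OF t]
  obtain \<pi> \<theta> where p: "\<And>k. \<pi> k \<in> Hom T P (A k)"
    "\<And>k i. \<pi> k \<bullet> \<iota> i = (if i = k then Ide T (A i) else Zer T (A i) (A k))"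
    and th: "\<And>k. \<theta> k \<in> Hom T P (A k)" "\<And>k. \<theta> k \<bullet> \<Phi> = \<pi> k"
    using telescope_projections[OF t] by (metis (no_types))
  have "\<pi> k \<bullet> q = Zer T K (A k)" for k
    using Cmp_assoc[OF q d(3) th(1)] th(2) z cmp_zer[OF th(1) compact_Ob[OF K]] by metis
  then show ?thesis using compact_projections_separate[OF K t q p] by blast
qed

text \<open>The connecting map sends \<open>x\<close> into the kernel of the shifted telescope map,
  which is injective on maps from \<open>K\<close>; hence \<open>x\<close> lifts to
  \<open>P\<close>. Compactness makes the lift a finite sum, and the summands can be pushed into one
  common stage.\<close>

lemma compact_factors_through_stage:
  assumes K: "K \<in> compact_objects U T" and t: "telescope A \<phi> P \<iota> \<Phi>" and tr: "triangle P P X \<Phi> g h"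
    and x: "x \<in> Hom T K X"
  obtains m f where "f \<in> Hom T K (A m)" "x = (g \<bullet> \<iota> m) \<bullet> f"
proof -
  note d = telescopeD[OF t]
  note r = triangleD[OF tr]
  note Ko = compact_Ob[OF K]
  have gi: "g \<bullet> \<iota> i \<in> Hom T (A i) X" for i using Cmp_Hom[OF d(5) r(2)] .
  have hx: "h \<bullet> x \<in> Hom T K (ShO T P)" using Cmp_Hom[OF x r(3)] .
  have "ShA T \<Phi> \<bullet> (h \<bullet> x) = Zer T K (ShO T P)"
    using Cmp_assoc[OF x r(3) sh_hom[OF d(3)]] triangle_cmp_zer3[OF tr] zer_cmp[OF x sh_Ob[OF d(7)]]
    by simp
  then have "h \<bullet> x = Zer T K (ShO T P)"
    using telescope_injective_on_compact[OF K telescope_shift[OF t] hx] by simp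
  then obtain p where p: "p \<in> Hom T K P" "x = g \<bullet> p" using triangle_exact2[OF tr x] by metis
  have "\<exists>m f. f \<in> Hom T K (A m) \<and> g \<bullet> p = (g \<bullet> \<iota> m) \<bullet> f"
  proof (rule compact_coproduct_induct[OF K d(2) p(1)])
    have z: "Zer T K (A 0) \<in> Hom T K (A 0)" using zer_hom[OF Ko d(6)] .
    have "g \<bullet> Zer T K P = (g \<bullet> \<iota> 0) \<bullet> Zer T K (A 0)"
      using cmp_zer[OF r(2) Ko] cmp_zer[OF gi Ko] by simp
    then show "\<exists>m f. f \<in> Hom T K (A m) \<and> g \<bullet> Zer T K P = (g \<bullet> \<iota> m) \<bullet> f" using z by blast
    show "\<exists>m f. f \<in> Hom T K (A m) \<and> g \<bullet> (\<iota> i \<bullet> z) = (g \<bullet> \<iota> m) \<bullet> f"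
      if z: "z \<in> Hom T K (A i)" for i z
      using Cmp_assoc[OF z d(5) r(2)] z by metis
    show "\<exists>m f. f \<in> Hom T K (A m) \<and> g \<bullet> (x \<boxplus> y) = (g \<bullet> \<iota> m) \<bullet> f"
      if x: "x \<in> Hom T K P" and y: "y \<in> Hom T K P"
        and ex: "\<exists>m f. f \<in> Hom T K (A m) \<and> g \<bullet> x = (g \<bullet> \<iota> m) \<bullet> f"
        and ey: "\<exists>m f. f \<in> Hom T K (A m) \<and> g \<bullet> y = (g \<bullet> \<iota> m) \<bullet> f" for x y
    proof -
      obtain m f where f: "f \<in> Hom T K (A m)" "g \<bullet> x = (g \<bullet> \<iota> m) \<bullet> f" using ex by blast
      obtain n f' where f': "f' \<in> Hom T K (A n)" "g \<bullet> y = (g \<bullet> \<iota> n) \<bullet> f'" using ey by blast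
      let ?l = "max m n"
      have push: "\<exists>u \<in> Hom T K (A ?l). (g \<bullet> \<iota> k) \<bullet> v = (g \<bullet> \<iota> ?l) \<bullet> u"
        if v: "v \<in> Hom T K (A k)" and kl: "k \<le> ?l" for k v
      proof
        show "path T A \<phi> k ?l \<bullet> v \<in> Hom T K (A ?l)" using Cmp_Hom[OF v path_hom[OF d(1) kl]] .
        show "(g \<bullet> \<iota> k) \<bullet> v = (g \<bullet> \<iota> ?l) \<bullet> (path T A \<phi> k ?l \<bullet> v)"
          using Cmp_assoc[OF v path_hom[OF d(1) kl] gi]
            telescope_cone_path[OF t r(2) triangle_cmp_zer[OF tr] kl] by simp
      qed
      obtain u where u: "u \<in> Hom T K (A ?l)" "g \<bullet> x = (g \<bullet> \<iota> ?l) \<bullet> u" using push[OF f(1)] f(2) by auto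
      obtain w where w: "w \<in> Hom T K (A ?l)" "g \<bullet> y = (g \<bullet> \<iota> ?l) \<bullet> w" using push[OF f'(1)] f'(2) by auto
      have "g \<bullet> (x \<boxplus> y) = (g \<bullet> \<iota> ?l) \<bullet> (u \<boxplus> w)"
        using Cmp_Add_right[OF x y r(2)] Cmp_Add_right[OF u(1) w(1) gi] u(2) w(2) by simp
      then show ?thesis using add_hom[OF u(1) w(1)] by blast
    qed
  qed
  then show ?thesis using that p(2) by blast
qed

text \<open>The map \<open>\<iota> n \<bullet> f\<close> dies in the cone, so it equals
  \<open>\<Phi> \<bullet> q\<close> for some \<open>q\<close>. Applying \<open>\<theta> k\<close>
  gives \<open>path T A \<phi> n k \<bullet> f = \<pi> k \<bullet> q\<close>, which is zero for
  large \<open>k\<close>.\<close>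

lemma compact_vanishing_at_stage:
  assumes K: "K \<in> compact_objects U T" and t: "telescope A \<phi> P \<iota> \<Phi>" and tr: "triangle P P X \<Phi> g h"
    and f: "f \<in> Hom T K (A n)" and z: "(g \<bullet> \<iota> n) \<bullet> f = Zer T K X"
  obtains N where "n \<le> N" "\<And>k. N \<le> k \<Longrightarrow> path T A \<phi> n k \<bullet> f = Zer T K (A k)"
proof -
  note d = telescopeD[OF t]
  note r = triangleD[OF tr]
  obtain \<pi> \<theta> where p: "\<And>k. \<pi> k \<in> Hom T P (A k)"
    "\<And>k i. \<pi> k \<bullet> \<iota> i = (if i = k then Ide T (A i) else Zer T (A i) (A k))"
    and th: "\<And>k. \<theta> k \<in> Hom T P (A k)" "\<And>k i. i \<le> k \<Longrightarrow> \<theta> k \<bullet> \<iota> i = path T A \<phi> i k"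
      "\<And>k. \<theta> k \<bullet> \<Phi> = \<pi> k"
    using telescope_projections[OF t] by (metis (no_types))
  have "g \<bullet> (\<iota> n \<bullet> f) = Zer T K X" using Cmp_assoc[OF f d(5) r(2)] z by simp
  then obtain q where q: "q \<in> Hom T K P" "\<iota> n \<bullet> f = \<Phi> \<bullet> q"
    using triangle_exact[OF tr Cmp_Hom[OF f d(5)]] by metis
  obtain N where N: "\<forall>k\<ge>N. \<pi> k \<bullet> q = Zer T K (A k)"
    using compact_projections_eventually_zero[OF K t q(1) p] by blast
  have "path T A \<phi> n k \<bullet> f = Zer T K (A k)" if "max n N \<le> k" for k
  proof -
    have "path T A \<phi> n k \<bullet> f = \<theta> k \<bullet> (\<Phi> \<bullet> q)"
      using th(2)[of n k] that Cmp_assoc[OF f d(5) th(1), of k] q(2) by (metis max.boundedE)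
    also have "\<dots> = \<pi> k \<bullet> q" using Cmp_assoc[OF q(1) d(3) th(1)] th(3) by simp
    finally show ?thesis using N that by simp
  qed
  then show ?thesis using that[of "max n N"] by simp
qed

section \<open>Passage to a subsequence\<close>

text \<open>The map \<open>x\<close> comes from some stage of the subsequence. If it dies in
  \<open>X\<close>, then it dies at a stage of the original sequence and, by cofinality of
  \<open>r\<close>, at a stage of the subsequence. The triangles and the map \<open>d\<close> are
  arbitrary because the lemma is applied to their shifts.\<close>

lemma subsequence_map_injective_on_compact:
  assumes K: "K \<in> compact_objects U T" and t: "telescope A \<phi> P \<iota> \<Phi>" and tr: "triangle P P X \<Phi> g h"
    and s: "strict_mono r"
    and t': "telescope (\<lambda>k. A (r k)) (\<lambda>k. path T A \<phi> (r k) (r (Suc k))) P' \<iota>' \<Phi>'"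
    and tr': "triangle P' P' X' \<Phi>' g' h'"
    and d: "d \<in> Hom T X' X" "\<And>k. d \<bullet> (g' \<bullet> \<iota>' k) = g \<bullet> \<iota> (r k)"
    and x: "x \<in> Hom T K X'" and z: "d \<bullet> x = Zer T K X"
  shows "x = Zer T K X'"
proof -
  note e = telescopeD[OF t] and e' = telescopeD[OF t']
  note q = triangleD[OF tr] and q' = triangleD[OF tr']
  obtain k f where f: "f \<in> Hom T K (A (r k))" "x = (g' \<bullet> \<iota>' k) \<bullet> f"
    using compact_factors_through_stage[OF K t' tr' x] by metis
  have gi: "g' \<bullet> \<iota>' k \<in> Hom T (A (r k)) X'" for k using Cmp_Hom[OF e'(5) q'(2)] .
  have "(g \<bullet> \<iota> (r k)) \<bullet> f = Zer T K X" using z f(2) Cmp_assoc[OF f(1) gi d(1)] d(2) by simp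
  then obtain N where N: "r k \<le> N" "\<And>l. N \<le> l \<Longrightarrow> path T A \<phi> (r k) l \<bullet> f = Zer T K (A l)"
    using compact_vanishing_at_stage[OF K t tr f(1)] by metis
  \<comment> \<open>Here \<open>N \<le> l \<le> r l\<close>, so the vanishing stage is passed within
    the subsequence.\<close>
  define l where "l = max k N"
  have kl: "k \<le> l" and Nl: "N \<le> r l" using strict_mono_imp_increasing[OF s, of l] by (auto simp: l_def)
  have "r k \<le> r l" using s kl by (simp add: strict_mono_less_eq)
  then have ph: "path T A \<phi> (r k) (r l) \<in> Hom T (A (r k)) (A (r l))" using path_hom[OF e(1)] by blast
  have "x = ((g' \<bullet> \<iota>' l) \<bullet> path T A \<phi> (r k) (r l)) \<bullet> f"
    using telescope_cone_path[OF t' q'(2) triangle_cmp_zer[OF tr'] kl]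
      path_subsequence[OF e(1) s kl] f(2) by simp
  also have "\<dots> = Zer T K X'"
    using Cmp_assoc[OF f(1) ph gi] N(2)[OF Nl] cmp_zer[OF gi compact_Ob[OF K]] by simp
  finally show ?thesis .
qed

text \<open>The comparison \<open>d\<close> from \<open>X'\<close> to \<open>X\<close> is surjective
  on maps from compact objects, and its shift is injective on them. So they have no nonzero map to
  the cone of \<open>d\<close>, compact generation makes that cone zero, and \<open>X\<close> can
  replace \<open>X'\<close>.\<close>

lemma hocolim_subsequence:
  assumes hc: "is_hocolim T A \<phi> X" and s: "strict_mono r"
  shows "is_hocolim T (\<lambda>k. A (r k)) (\<lambda>k. path T A \<phi> (r k) (r (Suc k))) X"
proof -
  let ?B = "\<lambda>k. A (r k)" and ?\<psi> = "\<lambda>k. path T A \<phi> (r k) (r (Suc k))"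
  obtain P \<iota> \<Phi> g h where t: "telescope A \<phi> P \<iota> \<Phi>" and tr: "triangle P P X \<Phi> g h"
    using hc by (auto simp: is_hocolim_iff)
  note e = telescopeD[OF t] and q = triangleD[OF tr]
  obtain P' \<iota>' where cop': "is_coproduct T UNIV ?B P' \<iota>'" using countable_coproduct_ex e(6) by metis
  obtain \<Phi>' where t': "telescope ?B ?\<psi> P' \<iota>' \<Phi>'"
    using telescope_ex[OF subsequence[OF e(1) s] cop'] by metis
  note e' = telescopeD[OF t']
  obtain X' g' h' where tr': "triangle P' P' X' \<Phi>' g' h'" using triangle_ex[OF e'(3)] by metis
  note q' = triangleD[OF tr']
  have gi: "g \<bullet> \<iota> k \<in> Hom T (A k) X" for k using Cmp_Hom[OF e(5) q(2)] .
  have Xo: "X \<in> Ob T" using Hom_Ob q by blast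
  obtain c where c: "c \<in> Hom T P' X" "\<And>k. c \<bullet> \<iota>' k = g \<bullet> \<iota> (r k)"
    using coproduct_lift[OF e'(2) Xo, of "\<lambda>k. g \<bullet> \<iota> (r k)"] gi by auto
  have "c \<bullet> \<Phi>' = Zer T P' X"
  proof (rule coproduct_eq[OF e'(2) Cmp_Hom[OF e'(3) c(1)] zer_hom[OF e'(7) Xo]])
    fix k
    have le: "r k \<le> r (Suc k)" using s by (simp add: strict_mono_less_eq)
    have "(c \<bullet> \<Phi>') \<bullet> \<iota>' k = (c \<bullet> \<iota>' k) \<boxplus> Neg T ((c \<bullet> \<iota>' (Suc k)) \<bullet> ?\<psi> k)"
      using Cmp_assoc[OF e'(5,3) c(1)] e'(8)[of k] cmp_sub[OF e'(5) Cmp_Hom[OF e'(4,5)] c(1)]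
        Cmp_assoc[OF e'(4,5) c(1)] by simp
    also have "(c \<bullet> \<iota>' (Suc k)) \<bullet> ?\<psi> k = g \<bullet> \<iota> (r k)"
      using c(2) telescope_cone_path[OF t q(2) triangle_cmp_zer[OF tr] le] by simp
    finally show "(c \<bullet> \<Phi>') \<bullet> \<iota>' k = Zer T P' X \<bullet> \<iota>' k"
      using c(2) add_neg[OF gi] zer_cmp[OF e'(5) Xo] by simp
  qed
  then obtain d where d: "d \<in> Hom T X' X" "c = d \<bullet> g'" using triangle_coexact[OF tr' c(1)] by metis
  have dk: "d \<bullet> (g' \<bullet> \<iota>' k) = g \<bullet> \<iota> (r k)" for k using Cmp_assoc[OF e'(5) q'(2) d(1)] d(2) c(2) by simp
  obtain W u w where tw: "triangle X' X W d u w" using triangle_ex[OF d(1)] by metis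
  note qw = triangleD[OF tw]
  have surj: "\<exists>y\<in>Hom T K X'. x = d \<bullet> y" if K: "K \<in> compact_objects U T" and x: "x \<in> Hom T K X" for K x
  proof -
    obtain m f where f: "f \<in> Hom T K (A m)" "x = (g \<bullet> \<iota> m) \<bullet> f"
      using compact_factors_through_stage[OF K t tr x] by metis
    \<comment> \<open>Stage \<open>m\<close> of the subsequence is stage \<open>r m \<ge> m\<close>
      of the sequence, so moving \<open>f\<close> there makes it come from
      \<open>X'\<close>.\<close>
    have mr: "m \<le> r m" using strict_mono_imp_increasing[OF s] .
    note pm = path_hom[OF e(1) mr]
    have gi': "g' \<bullet> \<iota>' m \<in> Hom T (A (r m)) X'" using Cmp_Hom[OF e'(5) q'(2)] .
    note pf = Cmp_Hom[OF f(1) pm]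
    have "x = ((g \<bullet> \<iota> (r m)) \<bullet> path T A \<phi> m (r m)) \<bullet> f"
      using telescope_cone_path[OF t q(2) triangle_cmp_zer[OF tr] mr] f(2) by simp
    also have "\<dots> = (d \<bullet> (g' \<bullet> \<iota>' m)) \<bullet> (path T A \<phi> m (r m) \<bullet> f)"
      using Cmp_assoc[OF f(1) pm gi] dk by simp
    also have "\<dots> = d \<bullet> ((g' \<bullet> \<iota>' m) \<bullet> (path T A \<phi> m (r m) \<bullet> f))"
      using Cmp_assoc[OF pf gi' d(1)] .
    finally show ?thesis using Cmp_Hom[OF pf gi'] by blast
  qed
  have shd: "ShA T d \<bullet> (ShA T g' \<bullet> ShA T (\<iota>' k)) = ShA T g \<bullet> ShA T (\<iota> (r k))" for k
    using sh_cmp[OF e'(5) q'(2)] sh_cmp[OF e(5) q(2)] sh_cmp[OF Cmp_Hom[OF e'(5) q'(2)] d(1)] dk[of k]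
    by metis
  \<comment> \<open>The shifted subsequence is a subsequence of the shifted sequence, with literally
    the same arrows; this is the form in which the injectivity lemma takes it.\<close>
  have psh: "(\<lambda>k. ShA T (?\<psi> k)) = (\<lambda>k. path T (\<lambda>n. ShO T (A n)) (\<lambda>n. ShA T (\<phi> n)) (r k) (r (Suc k)))"
    using sh_path[OF e(1)] s by (simp add: strict_mono_less_eq)
  note ts' = telescope_shift[OF t', unfolded psh]
  have "Hom T K W = {Zer T K W}" if K: "K \<in> compact_objects U T" for K
  proof -
    note Ko = compact_Ob[OF K]
    have Wo: "W \<in> Ob T" using Hom_Ob qw by blast
    have "x = Zer T K W" if x: "x \<in> Hom T K W" for x
    proof -
      have wx: "w \<bullet> x \<in> Hom T K (ShO T X')" using Cmp_Hom[OF x qw(3)] .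
      have "ShA T d \<bullet> (w \<bullet> x) = Zer T K (ShO T X)"
        using Cmp_assoc[OF x qw(3) sh_hom[OF d(1)]] triangle_cmp_zer3[OF tw] zer_cmp[OF x sh_Ob[OF Xo]]
        by simp
      then have "w \<bullet> x = Zer T K (ShO T X')"
        using subsequence_map_injective_on_compact[OF K telescope_shift[OF t] triangle_shift[OF tr] s
          ts' triangle_shift[OF tr'] sh_hom[OF d(1)] shd wx] by blast
      then obtain v where v: "v \<in> Hom T K X" "x = u \<bullet> v" using triangle_exact2[OF tw x] by metis
      obtain y where y: "y \<in> Hom T K X'" "v = d \<bullet> y" using surj[OF K v(1)] by blast
      have "x = (u \<bullet> d) \<bullet> y" using v(2) y(2) Cmp_assoc[OF y(1) d(1) qw(2)] by simp
      then show ?thesis using triangle_cmp_zer[OF tw] zer_cmp[OF y(1) Wo] by simp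
    qed
    then show ?thesis using zer_hom[OF Ko Wo] by blast
  qed
  then have "zero_object T W" using compact_generate Hom_Ob qw(2) by blast
  then have "is_iso_arrow T X' X d" using triangle_zero_cone_iso[OF tw] by blast
  then obtain h'' where "triangle P' P' X \<Phi>' (d \<bullet> g') h''" using triangle_replace_cone[OF tr'] by metis
  then show ?thesis using t' unfolding is_hocolim_iff by blast
qed

end

section \<open>Smashing subcategories\<close>

lemma full_subcat_simps [simp]:
  "Ob (full_subcat C S) = Ob C \<inter> S" "Ide (full_subcat C S) = Ide C" "Cmp (full_subcat C S) = Cmp C"
  by (simp_all add: full_subcat_def)

lemma Hom_full_subcat: "Hom (full_subcat C S) A B = (if A \<in> S \<and> B \<in> S then Hom C A B else {})"
  by (auto simp: full_subcat_def Hom_def)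

lemma (in category) category_full_subcat: "category (full_subcat C S)"
proof
  show "f \<in> Ar (full_subcat C S) \<Longrightarrow> Dom (full_subcat C S) f \<in> Ob (full_subcat C S)" for f
    by (auto simp: full_subcat_def Dom_Ob)
  show "f \<in> Ar (full_subcat C S) \<Longrightarrow> Cod (full_subcat C S) f \<in> Ob (full_subcat C S)" for f
    by (auto simp: full_subcat_def Cod_Ob)
qed (auto simp: Hom_full_subcat Ide_Hom Cmp_Hom Cmp_assoc Cmp_Ide Ide_Cmp split: if_splits)

lemma (in category) is_coproduct_full_subcat:
  assumes cop: "is_coproduct C I X P \<iota>" and X: "\<And>i. i \<in> I \<Longrightarrow> X i \<in> S" and P: "P \<in> S"
  shows "is_coproduct (full_subcat C S) I X P \<iota>"
  unfolding is_coproduct_def full_subcat_simps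
proof (intro conjI ballI allI impI)
  show "P \<in> Ob C \<inter> S" using P coproduct_Ob[OF cop] by blast
  show "X i \<in> Ob C \<inter> S" if "i \<in> I" for i using X coproduct_Ob[OF cop] that by blast
  show "\<iota> i \<in> Hom (full_subcat C S) (X i) P" if "i \<in> I" for i
    using X[OF that] P coproduct_hom[OF cop that] by (simp add: Hom_full_subcat)
  fix Y f assume Y: "Y \<in> Ob C \<inter> S" and f: "\<forall>i\<in>I. f i \<in> Hom (full_subcat C S) (X i) Y"
  then have "\<exists>!h. h \<in> Hom C P Y \<and> (\<forall>i\<in>I. h \<bullet> \<iota> i = f i)"
    using cop X unfolding is_coproduct_def by (simp add: Hom_full_subcat)
  then show "\<exists>!h. h \<in> Hom (full_subcat C S) P Y \<and> (\<forall>i\<in>I. h \<bullet> \<iota> i = f i)"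
    using P Y by (simp add: Hom_full_subcat)
qed

section \<open>Coreflection onto a full subcategory\<close>

context category
begin

text \<open>The right adjoint of the inclusion in counit form: arrows from \<open>S\<close> lift
  uniquely along \<open>\<epsilon> B\<close>. Composition with one arrow replaces the family of
  adjunction bijections.\<close>

definition coreflection where
  "coreflection S Go Ga \<epsilon> \<longleftrightarrow>
    (\<forall>B \<in> Ob C. Go B \<in> S \<and> \<epsilon> B \<in> Hom C (Go B) B) \<and>
    (\<forall>A \<in> S. \<forall>B \<in> Ob C. bij_betw (\<lambda>u. \<epsilon> B \<bullet> u) (Hom C A (Go B)) (Hom C A B)) \<and>
    (\<forall>B B'. \<forall>b \<in> Hom C B B'. Ga b \<in> Hom C (Go B) (Go B') \<and> \<epsilon> B' \<bullet> Ga b = b \<bullet> \<epsilon> B)"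

lemma coreflectionD:
  assumes "coreflection S Go Ga \<epsilon>"
  shows "B \<in> Ob C \<Longrightarrow> Go B \<in> S" "B \<in> Ob C \<Longrightarrow> \<epsilon> B \<in> Hom C (Go B) B"
    "b \<in> Hom C B B' \<Longrightarrow> Ga b \<in> Hom C (Go B) (Go B')"
    "b \<in> Hom C B B' \<Longrightarrow> \<epsilon> B' \<bullet> Ga b = b \<bullet> \<epsilon> B"
    "A \<in> S \<Longrightarrow> B \<in> Ob C \<Longrightarrow> bij_betw (\<lambda>u. \<epsilon> B \<bullet> u) (Hom C A (Go B)) (Hom C A B)"
  using assms unfolding coreflection_def by blast+

lemma coreflection_lift:
  assumes c: "coreflection S Go Ga \<epsilon>" and A: "A \<in> S" and f: "f \<in> Hom C A B"
  obtains u where "u \<in> Hom C A (Go B)" "\<epsilon> B \<bullet> u = f"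
proof -
  have "f \<in> (\<lambda>u. \<epsilon> B \<bullet> u) ` Hom C A (Go B)"
    using coreflectionD(5)[OF c A Hom_Ob(2)[OF f]] f by (simp add: bij_betw_def)
  then show ?thesis using that by blast
qed

lemma coreflection_cancel:
  assumes c: "coreflection S Go Ga \<epsilon>" and A: "A \<in> S" and B: "B \<in> Ob C"
    and uv: "u \<in> Hom C A (Go B)" "v \<in> Hom C A (Go B)" "\<epsilon> B \<bullet> u = \<epsilon> B \<bullet> v"
  shows "u = v"
  using coreflectionD(5)[OF c A B] uv by (auto simp: bij_betw_def inj_on_def)

text \<open>The counit \<open>\<epsilon> B\<close> corresponds to the identity of \<open>Go B\<close> under the adjunction.\<close>

lemma coreflection_of_right_adjoint:
  assumes S: "S \<subseteq> Ob C"
    and adj: "is_right_adjoint (full_subcat C S) C (\<lambda>A. A) (\<lambda>f. f) Go Ga"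
  obtains \<epsilon> where "coreflection S Go Ga \<epsilon>"
proof -
  let ?F = "full_subcat C S"
  have Oi: "Ob C \<inter> S = S" using S by blast
  obtain \<theta> where fnc: "is_functor C ?F Go Ga"
    and bij: "\<forall>A \<in> Ob ?F. \<forall>B \<in> Ob C. bij_betw (\<theta> A B) (Hom C A B) (Hom ?F A (Go B))"
    and nat: "\<forall>A \<in> Ob ?F. \<forall>A' \<in> Ob ?F. \<forall>B \<in> Ob C. \<forall>B' \<in> Ob C.
           \<forall>a \<in> Hom ?F A' A. \<forall>h \<in> Hom C A B. \<forall>b \<in> Hom C B B'.
             \<theta> A' B' (b \<bullet> h \<bullet> a) = Cmp ?F (Cmp ?F (Ga b) (\<theta> A B h)) a"
    using adj unfolding is_right_adjoint_def by blast
  have Go: "Go B \<in> S" "Ga (Ide C B) = Ide C (Go B)" if "B \<in> Ob C" for B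
    using fnc that by (auto simp: is_functor_def)
  have GoO: "Go B \<in> Ob C" if "B \<in> Ob C" for B using Go(1)[OF that] S by blast
  have Ga: "Ga b \<in> Hom C (Go B) (Go B')" if "b \<in> Hom C B B'" for b B B'
  proof -
    have "Ga b \<in> Hom ?F (Go B) (Go B')" using fnc that unfolding is_functor_def by blast
    then show ?thesis by (simp add: Hom_full_subcat split: if_splits)
  qed
  have bij': "bij_betw (\<theta> A B) (Hom C A B) (Hom C A (Go B))" if "A \<in> S" "B \<in> Ob C" for A B
    using bij that S Go(1) by (auto simp: Hom_full_subcat)
  have nat': "\<theta> A' B' ((b \<bullet> h) \<bullet> a) = (Ga b \<bullet> \<theta> A B h) \<bullet> a"
    if "A \<in> S" "A' \<in> S" "a \<in> Hom C A' A" "h \<in> Hom C A B" "b \<in> Hom C B B'" for A A' B B' a h b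
  proof -
    have 1: "A \<in> Ob ?F" "A' \<in> Ob ?F" "a \<in> Hom ?F A' A" using that S by (auto simp: Hom_full_subcat)
    show ?thesis
      using nat[rule_format, OF 1(1,2) Hom_Ob[OF that(5)] 1(3) that(4,5)] by simp
  qed
  have "\<exists>e. e \<in> Hom C (Go B) B \<and> \<theta> (Go B) B e = Ide C (Go B)" if B: "B \<in> Ob C" for B
  proof -
    have "Ide C (Go B) \<in> \<theta> (Go B) B ` Hom C (Go B) B"
      using bij'[OF Go(1)[OF B] B] Ide_Hom[OF GoO[OF B]] by (simp add: bij_betw_def)
    then show ?thesis by (metis imageE)
  qed
  then obtain \<epsilon> where e: "\<And>B. B \<in> Ob C \<Longrightarrow> \<epsilon> B \<in> Hom C (Go B) B"
    and te: "\<And>B. B \<in> Ob C \<Longrightarrow> \<theta> (Go B) B (\<epsilon> B) = Ide C (Go B)" by metis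
  \<comment> \<open>Naturality at the counit makes \<open>\<theta> A B\<close> a left inverse of
    composition with \<open>\<epsilon> B\<close>; its injectivity will make it a two-sided
    one.\<close>
  have tu: "\<theta> A B (\<epsilon> B \<bullet> u) = u" if A: "A \<in> S" and B: "B \<in> Ob C" and u: "u \<in> Hom C A (Go B)" for A B u
  proof -
    have "\<theta> A B ((Ide C B \<bullet> \<epsilon> B) \<bullet> u) = (Ga (Ide C B) \<bullet> \<theta> (Go B) B (\<epsilon> B)) \<bullet> u"
      using nat'[OF Go(1)[OF B] A u e[OF B] Ide_Hom[OF B]] .
    then show ?thesis
      using Ide_Cmp[OF e[OF B]] Go(2)[OF B] te[OF B] Ide_Cmp[OF Ide_Hom[OF GoO[OF B]]] Ide_Cmp[OF u]
      by simp
  qed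
  have "bij_betw (\<lambda>u. \<epsilon> B \<bullet> u) (Hom C A (Go B)) (Hom C A B)" if A: "A \<in> S" and B: "B \<in> Ob C" for A B
  proof (rule bij_betw_byWitness[where f' = "\<theta> A B"])
    note b = bij'[OF A B]
    show "\<forall>u\<in>Hom C A (Go B). \<theta> A B (\<epsilon> B \<bullet> u) = u" using tu[OF A B] by blast
    have tf: "\<theta> A B f \<in> Hom C A (Go B)" if "f \<in> Hom C A B" for f using b that by (auto simp: bij_betw_def)
    then show "\<theta> A B ` Hom C A B \<subseteq> Hom C A (Go B)" by blast
    show sub: "(\<lambda>u. \<epsilon> B \<bullet> u) ` Hom C A (Go B) \<subseteq> Hom C A B" using Cmp_Hom e[OF B] by blast
    have "\<epsilon> B \<bullet> \<theta> A B f = f" if f: "f \<in> Hom C A B" for f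
    proof -
      have "\<epsilon> B \<bullet> \<theta> A B f \<in> Hom C A B" using Cmp_Hom[OF tf[OF f] e[OF B]] .
      moreover have "\<theta> A B (\<epsilon> B \<bullet> \<theta> A B f) = \<theta> A B f" using tu[OF A B tf[OF f]] .
      ultimately show ?thesis using b f by (auto simp: bij_betw_def inj_on_def)
    qed
    then show "\<forall>f\<in>Hom C A B. \<epsilon> B \<bullet> \<theta> A B f = f" by blast
  qed
  moreover have "\<epsilon> B' \<bullet> Ga b = b \<bullet> \<epsilon> B" if b: "b \<in> Hom C B B'" for b B B'
  proof -
    have B: "B \<in> Ob C" "B' \<in> Ob C" using Hom_Ob[OF b] by auto
    have be: "b \<bullet> \<epsilon> B \<in> Hom C (Go B) B'" using Cmp_Hom[OF e[OF B(1)] b] .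
    have "\<theta> (Go B) B' ((b \<bullet> \<epsilon> B) \<bullet> Ide C (Go B)) = (Ga b \<bullet> \<theta> (Go B) B (\<epsilon> B)) \<bullet> Ide C (Go B)"
      using nat'[OF Go(1)[OF B(1)] Go(1)[OF B(1)] Ide_Hom[OF GoO[OF B(1)]] e[OF B(1)] b] .
    then have "\<theta> (Go B) B' (b \<bullet> \<epsilon> B) = \<theta> (Go B) B' (\<epsilon> B' \<bullet> Ga b)"
      using te[OF B(1)] Cmp_Ide[OF be] Cmp_Ide[OF Ga[OF b]] tu[OF Go(1)[OF B(1)] B(2) Ga[OF b]] by simp
    then show ?thesis
      using bij'[OF Go(1)[OF B(1)] B(2)] be Cmp_Hom[OF Ga[OF b] e[OF B(2)]]
      by (auto simp: bij_betw_def inj_on_def)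
  qed
  ultimately have "coreflection S Go Ga \<epsilon>" unfolding coreflection_def using Go e Ga by blast
  then show ?thesis using that by blast
qed

end

context triangulated_category
begin

section \<open>The cones of \<open>1 - HG\<close> and \<open>1 - GH\<close>\<close>

text \<open>Set \<open>e = 1 - v\<close>. Then \<open>e \<bullet> a = a \<bullet> \<Phi>\<close> and
  \<open>b \<bullet> e = ShA T \<Phi> \<bullet> b\<close> are both zero. The first makes
  \<open>e\<close> factor as \<open>e' \<bullet> b\<close>, the second then gives
  \<open>e \<bullet> e = 0\<close>, so \<open>v = 1 - e\<close> is invertible.\<close>

lemma cone_endomorphism_iso:
  assumes u: "u \<in> Hom T P P" and \<Phi>: "\<Phi> = Ide T P \<boxplus> Neg T u" and t: "triangle P P X \<Phi> a b"
    and v: "v \<in> Hom T X X" "v \<bullet> a = a \<bullet> u" "ShA T u \<bullet> b = b \<bullet> v"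
  shows "is_iso_arrow T X X v"
proof -
  note h = triangleD[OF t]
  have P: "P \<in> Ob T" and X: "X \<in> Ob T" using Hom_Ob h by blast+
  note iP = Ide_Hom[OF P] and iX = Ide_Hom[OF X]
  define e where "e = Ide T X \<boxplus> Neg T v"
  have e: "e \<in> Hom T X X" using add_hom[OF iX neg_hom[OF v(1)]] by (simp add: e_def)
  have "e \<bullet> a = a \<bullet> \<Phi>"
    using sub_cmp[OF h(2) iX v(1)] cmp_sub[OF iP u h(2)] v(2) Ide_Cmp[OF h(2)] Cmp_Ide[OF h(2)]
    by (simp add: e_def \<Phi>)
  then have "e \<bullet> a = Zer T P X" using triangle_cmp_zer[OF t] by simp
  then obtain e' where e': "e' \<in> Hom T (ShO T P) X" "e = e' \<bullet> b"
    using triangle_coexact2[OF t e] by metis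
  have "ShA T \<Phi> = Ide T (ShO T P) \<boxplus> Neg T (ShA T u)"
    using shift_additive[OF iP neg_hom[OF u]] sh_Ide[OF P] sh_neg[OF u] by (simp add: \<Phi>)
  then have "b \<bullet> e = ShA T \<Phi> \<bullet> b"
    using sub_cmp[OF h(3) Ide_Hom[OF sh_Ob[OF P]] sh_hom[OF u]] cmp_sub[OF iX v(1) h(3)] v(3)
      Ide_Cmp[OF h(3)] Cmp_Ide[OF h(3)] by (simp add: e_def)
  then have "b \<bullet> e = Zer T X (ShO T P)" using triangle_cmp_zer3[OF t] by simp
  then have ee: "e \<bullet> e = Zer T X X"
    using Cmp_assoc[OF e h(3) e'(1)] e'(2) cmp_zer[OF e'(1) X] by simp
  have "v = Ide T X \<boxplus> Neg T e"
  proof -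
    have "Ide T X = v \<boxplus> e" using sub_add_cancel[OF iX v(1)] add_comm[OF e v(1)] by (simp add: e_def)
    then have "Ide T X \<boxplus> Neg T e = v \<boxplus> (e \<boxplus> Neg T e)" using add_assoc[OF v(1) e neg_hom[OF e]] by simp
    then show ?thesis using add_neg[OF e] add_zer[OF v(1)] by simp
  qed
  then show ?thesis
    using iso_arrowI[OF v(1) add_hom[OF iX e] add_hom[OF iX e]] sub_square_zer_right_inverse[OF e ee]
    by simp
qed

text \<open>\<open>G\<close> and \<open>H\<close> intertwine the two endomorphisms, so they induce
  maps between the cones. These need not be mutually inverse, but their composites lie over
  \<open>H \<bullet> G\<close> and \<open>G \<bullet> H\<close>, where the square-zero argument
  applies.\<close>

lemma cone_one_sub_cmp_comm:
  assumes G: "G \<in> Hom T P Q" and H: "H \<in> Hom T Q P"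
    and t: "triangle P P X (Ide T P \<boxplus> Neg T (H \<bullet> G)) a b"
    and t': "triangle Q Q Y (Ide T Q \<boxplus> Neg T (G \<bullet> H)) a' b'"
  shows "isomorphic T X Y"
proof -
  note h = triangleD[OF t] and h' = triangleD[OF t']
  have P: "P \<in> Ob T" and Q: "Q \<in> Ob T" and X: "X \<in> Ob T" and Y: "Y \<in> Ob T" using Hom_Ob h h' by blast+
  note HG = Cmp_Hom[OF G H] and GH = Cmp_Hom[OF H G]
  have cG: "G \<bullet> (Ide T P \<boxplus> Neg T (H \<bullet> G)) = (Ide T Q \<boxplus> Neg T (G \<bullet> H)) \<bullet> G"
    using cmp_sub[OF Ide_Hom[OF P] HG G] sub_cmp[OF G Ide_Hom[OF Q] GH] Cmp_Ide[OF G] Ide_Cmp[OF G]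
      Cmp_assoc[OF G H G] by simp
  have cH: "H \<bullet> (Ide T Q \<boxplus> Neg T (G \<bullet> H)) = (Ide T P \<boxplus> Neg T (H \<bullet> G)) \<bullet> H"
    using cmp_sub[OF Ide_Hom[OF Q] GH H] sub_cmp[OF H Ide_Hom[OF P] HG] Cmp_Ide[OF H] Ide_Cmp[OF H]
      Cmp_assoc[OF H G H] by simp
  obtain d where d: "d \<in> Hom T X Y" "d \<bullet> a = a' \<bullet> G" "ShA T G \<bullet> b = b' \<bullet> d"
    using triangle_morphism[OF t t' G G cG] by metis
  obtain d' where d': "d' \<in> Hom T Y X" "d' \<bullet> a' = a \<bullet> H" "ShA T H \<bullet> b' = b \<bullet> d'"
    using triangle_morphism[OF t' t H H cH] by metis
  have 1: "is_iso_arrow T X X (d' \<bullet> d)"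
  proof (rule cone_endomorphism_iso[OF HG refl t Cmp_Hom[OF d(1) d'(1)]])
    show "(d' \<bullet> d) \<bullet> a = a \<bullet> (H \<bullet> G)"
      using Cmp_assoc[OF h(2) d(1) d'(1)] Cmp_assoc[OF G h'(2) d'(1)] Cmp_assoc[OF G H h(2)] d(2) d'(2)
      by simp
    show "ShA T (H \<bullet> G) \<bullet> b = b \<bullet> (d' \<bullet> d)"
      using sh_cmp[OF G H] Cmp_assoc[OF h(3) sh_hom[OF G] sh_hom[OF H]]
        Cmp_assoc[OF d(1) h'(3) sh_hom[OF H]] Cmp_assoc[OF d(1) d'(1) h(3)] d(3) d'(3) by simp
  qed
  have 2: "is_iso_arrow T Y Y (d \<bullet> d')"
  proof (rule cone_endomorphism_iso[OF GH refl t' Cmp_Hom[OF d'(1) d(1)]])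
    show "(d \<bullet> d') \<bullet> a' = a' \<bullet> (G \<bullet> H)"
      using Cmp_assoc[OF h'(2) d'(1) d(1)] Cmp_assoc[OF H h(2) d(1)] Cmp_assoc[OF H G h'(2)] d(2) d'(2)
      by simp
    show "ShA T (G \<bullet> H) \<bullet> b' = b' \<bullet> (d \<bullet> d')"
      using sh_cmp[OF H G] Cmp_assoc[OF h'(3) sh_hom[OF H] sh_hom[OF G]]
        Cmp_assoc[OF d'(1) h(3) sh_hom[OF G]] Cmp_assoc[OF d'(1) d(1) h'(3)] d(3) d'(3) by simp
  qed
  \<comment> \<open>An inverse of \<open>d' \<bullet> d\<close> yields a left inverse of
    \<open>d\<close>, one of \<open>d \<bullet> d'\<close> a right inverse.\<close>
  obtain v where v: "v \<in> Hom T X X" "v \<bullet> (d' \<bullet> d) = Ide T X" using 1 iso_arrow_inverse by metis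
  obtain w where w: "w \<in> Hom T Y Y" "(d \<bullet> d') \<bullet> w = Ide T Y" using 2 iso_arrow_inverse by metis
  have "is_iso_arrow T X Y d"
    using iso_arrowI[OF d(1) Cmp_Hom[OF d'(1) v(1)] Cmp_Hom[OF w(1) d'(1)]]
      Cmp_assoc[OF d(1) d'(1) v(1)] Cmp_assoc[OF w(1) d'(1) d(1)] v(2) w(2) by simp
  then show ?thesis using X Y by (auto simp: isomorphic_def)
qed

section \<open>Coreflection along shifts and triangles\<close>

text \<open>Stands in for compatibility of the coreflection with the shift. Up to isomorphism
  \<open>X\<close> is \<open>ShO T W\<close>, and \<open>W\<close> lies in \<open>S\<close> because
  membership is invariant under the shift in both directions; the shift carries the universal
  property of \<open>\<epsilon> B\<close> from \<open>W\<close> to \<open>X\<close>.\<close>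

lemma coreflection_shift:
  assumes S: "triangulated_subcategory T S" and c: "coreflection S Go Ga \<epsilon>" and X: "X \<in> S"
    and B: "B \<in> Ob T"
  shows "bij_betw (\<lambda>u. ShA T (\<epsilon> B) \<bullet> u) (Hom T X (ShO T (Go B))) (Hom T X (ShO T B))"
proof -
  have SO: "S \<subseteq> Ob T" using S by (simp add: triangulated_subcategory_def)
  have Xo: "X \<in> Ob T" and Go: "Go B \<in> Ob T" using SO X coreflectionD(1)[OF c B] by blast+
  note e = coreflectionD(2)[OF c B]
  note se = sh_hom[OF e]
  obtain W where W: "W \<in> Ob T" "isomorphic T (ShO T W) X" using sh_essentially_surjective[OF Xo] by metis
  then have "ShO T W \<in> S" using S X isomorphic_sym unfolding triangulated_subcategory_def by blast
  then have WS: "W \<in> S" using S W(1) by (simp add: triangulated_subcategory_def)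
  obtain a where a: "is_iso_arrow T (ShO T W) X a" using W(2) by (auto simp: isomorphic_def)
  obtain b where b: "b \<in> Hom T X (ShO T W)" "b \<bullet> a = Ide T (ShO T W)" "a \<bullet> b = Ide T X"
    using a iso_arrow_inverse by metis
  have ah: "a \<in> Hom T (ShO T W) X" using a by (simp add: is_iso_arrow_def)
  show ?thesis
    unfolding bij_betw_def
  proof
    show "inj_on (\<lambda>u. ShA T (\<epsilon> B) \<bullet> u) (Hom T X (ShO T (Go B)))"
    proof (rule inj_onI)
      fix u v assume u: "u \<in> Hom T X (ShO T (Go B))" and v: "v \<in> Hom T X (ShO T (Go B))"
        and uv: "ShA T (\<epsilon> B) \<bullet> u = ShA T (\<epsilon> B) \<bullet> v"
      obtain k where k: "k \<in> Hom T W (Go B)" "ShA T k = u \<bullet> a"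
        using sh_full[OF Cmp_Hom[OF ah u] W(1) Go] by metis
      obtain l where l: "l \<in> Hom T W (Go B)" "ShA T l = v \<bullet> a"
        using sh_full[OF Cmp_Hom[OF ah v] W(1) Go] by metis
      have "ShA T (\<epsilon> B \<bullet> k) = ShA T (\<epsilon> B \<bullet> l)"
        using sh_cmp[OF k(1) e] sh_cmp[OF l(1) e] k(2) l(2) Cmp_assoc[OF ah u se] Cmp_assoc[OF ah v se] uv
        by simp
      then have "\<epsilon> B \<bullet> k = \<epsilon> B \<bullet> l" using sh_faithful[OF Cmp_Hom[OF k(1) e] Cmp_Hom[OF l(1) e]] by simp
      then have "k = l" using coreflection_cancel[OF c WS B k(1) l(1)] by simp
      then have "(u \<bullet> a) \<bullet> b = (v \<bullet> a) \<bullet> b" using k(2) l(2) by simp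
      then show "u = v"
        using Cmp_assoc[OF b(1) ah u] Cmp_assoc[OF b(1) ah v] b(3) Cmp_Ide[OF u] Cmp_Ide[OF v] by simp
    qed
    have "\<exists>u \<in> Hom T X (ShO T (Go B)). x = ShA T (\<epsilon> B) \<bullet> u" if x: "x \<in> Hom T X (ShO T B)" for x
    proof -
      obtain k where k: "k \<in> Hom T W B" "ShA T k = x \<bullet> a"
        using sh_full[OF Cmp_Hom[OF ah x] W(1) B] by metis
      obtain l where l: "l \<in> Hom T W (Go B)" "\<epsilon> B \<bullet> l = k" using coreflection_lift[OF c WS k(1)] by metis
      have "ShA T (\<epsilon> B) \<bullet> (ShA T l \<bullet> b) = (x \<bullet> a) \<bullet> b"
        using Cmp_assoc[OF b(1) sh_hom[OF l(1)] se] sh_cmp[OF l(1) e] l(2) k(2) by simp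
      also have "\<dots> = x" using Cmp_assoc[OF b(1) ah x] b(3) Cmp_Ide[OF x] by simp
      finally show ?thesis using Cmp_Hom[OF b(1) sh_hom[OF l(1)]] by metis
    qed
    then show "(\<lambda>u. ShA T (\<epsilon> B) \<bullet> u) ` Hom T X (ShO T (Go B)) = Hom T X (ShO T B)"
      using Cmp_Hom[OF _ se] by blast
  qed
qed

text \<open>The surjective half of the five lemma for \<open>Hom T X\<close>.\<close>

lemma coreflected_cone_section:
  assumes S: "triangulated_subcategory T S" and c: "coreflection S Go Ga \<epsilon>" and X: "X \<in> S"
    and tr: "triangle P P X \<Phi> g h" and tr': "triangle (Go P) (Go P) X' \<Phi>' g' h'"
    and comm: "\<epsilon> P \<bullet> \<Phi>' = \<Phi> \<bullet> \<epsilon> P"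
    and d: "d \<in> Hom T X' X" "d \<bullet> g' = g \<bullet> \<epsilon> P" "ShA T (\<epsilon> P) \<bullet> h' = h \<bullet> d"
  obtains s where "s \<in> Hom T X X'" "d \<bullet> s = Ide T X"
proof -
  note q = triangleD[OF tr] and q' = triangleD[OF tr']
  have P: "P \<in> Ob T" and Xo: "X \<in> Ob T" and X'o: "X' \<in> Ob T" using Hom_Ob q q' by blast+
  note e = coreflectionD(2)[OF c P]
  note se = sh_hom[OF e]
  have Go: "Go P \<in> Ob T" using Hom_Ob e by blast
  note bij = coreflection_shift[OF S c X P]
  have inj: "u = v" if "u \<in> Hom T X (ShO T (Go P))" "v \<in> Hom T X (ShO T (Go P))"
      "ShA T (\<epsilon> P) \<bullet> u = ShA T (\<epsilon> P) \<bullet> v" for u v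
    using bij that by (auto simp: bij_betw_def inj_on_def)
  \<comment> \<open>First candidate for the section: lift \<open>h\<close> to \<open>t\<close>. By
    uniqueness of lifts \<open>ShA T \<Phi>'\<close> kills \<open>t\<close>, so \<open>t\<close>
    comes from a map \<open>s\<close> into \<open>X'\<close>.\<close>
  have "h \<in> (\<lambda>u. ShA T (\<epsilon> P) \<bullet> u) ` Hom T X (ShO T (Go P))" using bij q(3) by (simp add: bij_betw_def)
  then obtain t where t: "t \<in> Hom T X (ShO T (Go P))" "ShA T (\<epsilon> P) \<bullet> t = h" by (metis imageE)
  note s\<Phi> = sh_hom[OF q(1)] and s\<Phi>' = sh_hom[OF q'(1)]
  have "ShA T (\<epsilon> P) \<bullet> (ShA T \<Phi>' \<bullet> t) = ShA T \<Phi> \<bullet> h"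
    using Cmp_assoc[OF t(1) s\<Phi>' se] sh_cmp[OF q'(1) e] comm sh_cmp[OF e q(1)] Cmp_assoc[OF t(1) se s\<Phi>] t(2)
    by simp
  also have "\<dots> = ShA T (\<epsilon> P) \<bullet> Zer T X (ShO T (Go P))"
    using triangle_cmp_zer3[OF tr] cmp_zer[OF se Xo] by simp
  finally have "ShA T \<Phi>' \<bullet> t = Zer T X (ShO T (Go P))"
    using inj[OF Cmp_Hom[OF t(1) s\<Phi>'] zer_hom[OF Xo sh_Ob[OF Go]]] by simp
  then obtain s where s: "s \<in> Hom T X X'" "t = h' \<bullet> s" using triangle_exact3[OF tr' t(1)] by metis
  note ds = Cmp_Hom[OF s(1) d(1)]
  note iX = Ide_Hom[OF Xo]
  \<comment> \<open>\<open>h\<close> does not distinguish \<open>d \<bullet> s\<close> from the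
    identity, so the error comes from \<open>P\<close>. Lifting it to \<open>Go P\<close> gives the
    correction \<open>g' \<bullet> v\<close> that is added to \<open>s\<close>.\<close>
  have "h \<bullet> (d \<bullet> s) = h"
    using Cmp_assoc[OF s(1) d(1) q(3)] d(3) Cmp_assoc[OF s(1) q'(3) se] s(2) t(2) by simp
  then have "h \<bullet> (Ide T X \<boxplus> Neg T (d \<bullet> s)) = Zer T X (ShO T P)"
    using cmp_sub[OF iX ds q(3)] Cmp_Ide[OF q(3)] add_neg[OF q(3)] by simp
  then obtain u where u: "u \<in> Hom T X P" "Ide T X \<boxplus> Neg T (d \<bullet> s) = g \<bullet> u"
    using triangle_exact2[OF tr add_hom[OF iX neg_hom[OF ds]]] by metis
  obtain v where v: "v \<in> Hom T X (Go P)" "\<epsilon> P \<bullet> v = u" using coreflection_lift[OF c X u(1)] by metis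
  note gv = Cmp_Hom[OF v(1) q'(2)]
  have "d \<bullet> (g' \<bullet> v) = g \<bullet> u"
    using Cmp_assoc[OF v(1) q'(2) d(1)] d(2) Cmp_assoc[OF v(1) e q(2)] v(2) by simp
  then have "d \<bullet> ((g' \<bullet> v) \<boxplus> s) = Ide T X"
    using Cmp_Add_right[OF gv s(1) d(1)] u(2) sub_add_cancel[OF iX ds] by metis
  then show ?thesis using that add_hom[OF gv s(1)] by blast
qed

end

context compactly_generated_triangulated_category
begin

section \<open>Smashing subcategories and countable coproducts\<close>

text \<open>Preservation of coproducts speaks of coproducts in the full subcategory. As
  \<open>S\<close> is closed under coproducts of \<open>T\<close>, the coproduct formed in
  \<open>T\<close> is also one in the subcategory, and comparing the two shows that
  \<open>Go P\<close> is a coproduct in \<open>T\<close>.\<close>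

lemma smashing_coreflection:
  assumes sm: "smashing_subcategory U T S"
  obtains Go Ga \<epsilon> where "coreflection S Go Ga \<epsilon>"
    "\<And>X P \<iota>. is_coproduct T (UNIV :: nat set) X P \<iota>
      \<Longrightarrow> is_coproduct T UNIV (\<lambda>n. Go (X n)) (Go P) (\<lambda>n. Ga (\<iota> n))"
proof -
  let ?F = "full_subcat T S"
  have loc: "localizing_subcategory U T S"
    using sm by (simp add: smashing_subcategory_def strictly_localizing_subcategory_def)
  then have SO: "S \<subseteq> Ob T" by (simp add: localizing_subcategory_def triangulated_subcategory_def)
  obtain Go Ga where adj: "is_right_adjoint ?F T (\<lambda>A. A) (\<lambda>f. f) Go Ga"
    and pres: "preserves_small_coproducts U T ?F Go Ga"
    using sm by (auto simp: smashing_subcategory_def inclusion_right_adjoint_def)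
  obtain \<epsilon> where c: "coreflection S Go Ga \<epsilon>" using coreflection_of_right_adjoint[OF SO adj] by metis
  have "is_coproduct T UNIV (\<lambda>n. Go (X n)) (Go P) (\<lambda>n. Ga (\<iota> n))"
    if cop: "is_coproduct T (UNIV :: nat set) X P \<iota>" for X P \<iota>
  proof -
    obtain f :: "nat \<Rightarrow> 'u" where f: "bij_betw f UNIV (range f)" "range f \<subseteq> U" "small U (range f)"
      using nat_embeds_small by blast
    define g where "g = inv_into UNIV f"
    have gf: "g (f n) = n" for n using f(1) by (simp add: g_def bij_betw_def)
    have cop': "is_coproduct T (range f) (\<lambda>i. X (g i)) P (\<lambda>i. \<iota> (g i))"
      unfolding g_def using coproduct_reindex[OF f(1) cop] .
    have G: "is_coproduct ?F (range f) (\<lambda>i. Go (X (g i))) (Go P) (\<lambda>i. Ga (\<iota> (g i)))"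
      using pres[unfolded preserves_small_coproducts_def, rule_format, OF conjI[OF f(2) conjI[OF f(3) cop']]] .
    have Xo: "X n \<in> Ob T" for n using coproduct_Ob[OF cop] by simp
    have GS: "Go (X n) \<in> S" for n using coreflectionD(1)[OF c Xo] .
    then have GO: "\<forall>i\<in>range f. Go (X (g i)) \<in> Ob T" using SO by blast
    obtain Q \<kappa> where Q: "is_coproduct T (range f) (\<lambda>i. Go (X (g i))) Q \<kappa>"
      using small_coproducts[unfolded has_small_coproducts_def, rule_format,
          of "range f" "\<lambda>i. Go (X (g i))"] f(2,3) GO by metis
    have clo: "\<forall>I X P \<iota>. I \<subseteq> U \<and> small U I \<and> (\<forall>i \<in> I. X i \<in> S) \<and> is_coproduct T I X P \<iota> \<longrightarrow> P \<in> S"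
      using loc by (simp add: localizing_subcategory_def)
    have QS: "Q \<in> S"
      by (rule clo[rule_format, of "range f" "\<lambda>i. Go (X (g i))" Q \<kappa>]) (use f(2,3) GS Q in blast)
    have QF: "is_coproduct ?F (range f) (\<lambda>i. Go (X (g i))) Q \<kappa>"
      using is_coproduct_full_subcat[OF Q GS QS] .
    obtain u where u: "is_iso_arrow ?F Q (Go P) u"
      "\<And>i. i \<in> range f \<Longrightarrow> Cmp ?F u (\<kappa> i) = Ga (\<iota> (g i))"
      using category.coproduct_comparison[OF category_full_subcat QF G] by metis
    have "is_iso_arrow T Q (Go P) u"
      using u(1) by (auto simp: is_iso_arrow_def Hom_full_subcat split: if_splits)
    then have "is_coproduct T (range f) (\<lambda>i. Go (X (g i))) (Go P) (\<lambda>i. Ga (\<iota> (g i)))"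
      by (rule coproduct_transport[OF Q]) (use u(2) in simp)
    from coproduct_reindex_back[OF f(1) this] show ?thesis by (simp add: gf)
  qed
  then show ?thesis using that c by blast
qed

section \<open>Homotopy colimits and membership in \<open>S\<close>\<close>

lemma localizing_countable_coproduct:
  assumes loc: "localizing_subcategory U T S" and cop: "is_coproduct T (UNIV :: nat set) X P \<iota>"
    and X: "\<And>n. X n \<in> S"
  shows "P \<in> S"
proof -
  obtain f :: "nat \<Rightarrow> 'u" where f: "bij_betw f UNIV (range f)" "range f \<subseteq> U" "small U (range f)"
    using nat_embeds_small by blast
  have clo: "\<forall>I X P \<iota>. I \<subseteq> U \<and> small U I \<and> (\<forall>i \<in> I. X i \<in> S) \<and> is_coproduct T I X P \<iota> \<longrightarrow> P \<in> S"
    using loc by (simp add: localizing_subcategory_def)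
  show ?thesis
    by (rule clo[rule_format, of "range f" "\<lambda>i. X (inv_into UNIV f i)" P "\<lambda>i. \<iota> (inv_into UNIV f i)"])
      (use f(2,3) X coproduct_reindex[OF f(1) cop] in blast)
qed

text \<open>If \<open>\<phi> n = b n \<bullet> a n\<close> factors through \<open>Y n\<close>, then \<open>\<Phi> = 1 - H \<bullet> G\<close> for the induced maps
  \<open>G\<close>, \<open>H\<close> between \<open>P\<close> and the coproduct of the \<open>Y n\<close>, and the cone of \<open>1 - G \<bullet> H\<close> lies in \<open>S\<close>.\<close>

lemma hocolim_in_localizing:
  assumes loc: "localizing_subcategory U T S" and hc: "is_hocolim T A \<phi> X"
    and fac: "\<And>n. \<exists>Y \<in> S. \<exists>a \<in> Hom T (A n) Y. \<exists>b \<in> Hom T Y (A (Suc n)). \<phi> n = b \<bullet> a"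
  shows "X \<in> S"
proof -
  have tri: "triangulated_subcategory T S" using loc by (simp add: localizing_subcategory_def)
  then have SO: "S \<subseteq> Ob T" by (simp add: triangulated_subcategory_def)
  obtain P \<iota> \<Phi> g h where t: "telescope A \<phi> P \<iota> \<Phi>" and tr: "triangle P P X \<Phi> g h"
    using hc by (auto simp: is_hocolim_iff)
  note e = telescopeD[OF t]
  have "\<exists>Y a b. Y \<in> S \<and> a \<in> Hom T (A n) Y \<and> b \<in> Hom T Y (A (Suc n)) \<and> \<phi> n = b \<bullet> a" for n
    using fac[of n] by blast
  then obtain Y a b where Y: "\<And>n. Y n \<in> S" and a: "\<And>n. a n \<in> Hom T (A n) (Y n)"
    and b: "\<And>n. b n \<in> Hom T (Y n) (A (Suc n))" and ab: "\<And>n. \<phi> n = b n \<bullet> a n"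
    by metis
  have Yo: "Y n \<in> Ob T" for n using Y SO by blast
  obtain Q \<kappa> where Q: "is_coproduct T UNIV Y Q \<kappa>" using countable_coproduct_ex[of Y] Yo by metis
  have QS: "Q \<in> S" using localizing_countable_coproduct[OF loc Q Y] .
  have Qo: "Q \<in> Ob T" using QS SO by blast
  have k: "\<kappa> n \<in> Hom T (Y n) Q" for n using coproduct_hom[OF Q] by simp
  obtain G where G: "G \<in> Hom T P Q" "\<And>n. G \<bullet> \<iota> n = \<kappa> n \<bullet> a n"
    using coproduct_lift[OF e(2) Qo, of "\<lambda>n. \<kappa> n \<bullet> a n"] Cmp_Hom[OF a k] by auto
  \<comment> \<open>\<open>H\<close> raises the index by one, since \<open>b n\<close> ends in
    \<open>A (Suc n)\<close>; thus \<open>H \<bullet> G\<close> is the one-step map of the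
    sequence.\<close>
  obtain H where H: "H \<in> Hom T Q P" "\<And>n. H \<bullet> \<kappa> n = \<iota> (Suc n) \<bullet> b n"
    using coproduct_lift[OF Q e(7), of "\<lambda>n. \<iota> (Suc n) \<bullet> b n"] Cmp_Hom[OF b e(5)] by auto
  note iP = Ide_Hom[OF e(7)] and HG = Cmp_Hom[OF G(1) H(1)]
  have "\<Phi> = Ide T P \<boxplus> Neg T (H \<bullet> G)"
  proof (rule coproduct_eq[OF e(2,3) add_hom[OF iP neg_hom[OF HG]]])
    fix n
    have "(H \<bullet> G) \<bullet> \<iota> n = (H \<bullet> \<kappa> n) \<bullet> a n"
      using Cmp_assoc[OF e(5) G(1) H(1)] G(2) Cmp_assoc[OF a k H(1)] by simp
    also have "\<dots> = \<iota> (Suc n) \<bullet> \<phi> n" using H(2) Cmp_assoc[OF a b e(5)] ab by simp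
    finally show "\<Phi> \<bullet> \<iota> n = (Ide T P \<boxplus> Neg T (H \<bullet> G)) \<bullet> \<iota> n"
      using sub_cmp[OF e(5) iP HG] Ide_Cmp[OF e(5)] e(8)[of n] by simp
  qed
  note tr1 = tr[unfolded this]
  have "Ide T Q \<boxplus> Neg T (G \<bullet> H) \<in> Hom T Q Q"
    using add_hom[OF Ide_Hom[OF Qo] neg_hom[OF Cmp_Hom[OF H(1) G(1)]]] .
  then obtain C a' b' where tr2: "triangle Q Q C (Ide T Q \<boxplus> Neg T (G \<bullet> H)) a' b'"
    using triangle_ex by metis
  have cone: "\<forall>f g h. Tri T f g h \<and> Dom T f \<in> S \<and> Cod T f \<in> S \<longrightarrow> Cod T g \<in> S"
    using tri by (simp add: triangulated_subcategory_def)
  have "C \<in> S"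
    using cone[rule_format, of "Ide T Q \<boxplus> Neg T (G \<bullet> H)" a' b'] triangleD[OF tr2] QS
    by (simp add: Hom_def)
  moreover have "isomorphic T C X"
    using isomorphic_sym[OF cone_one_sub_cmp_comm[OF G(1) H(1) tr1 tr2]] .
  ultimately show ?thesis using tri unfolding triangulated_subcategory_def by blast
qed

text \<open>The factorization appears only at a later stage, so it concerns paths rather than the
  given \<open>\<phi> n\<close>. The inequality is strict so that iteration yields a strictly
  increasing sequence of stages.\<close>

lemma hocolim_paths_in_ideal:
  assumes sm: "smashing_subcategory U T S" and X: "X \<in> S" and hc: "is_hocolim T A \<phi> X"
    and A: "\<And>n. A n \<in> compact_objects U T"
  shows "\<exists>m>n. path T A \<phi> n m \<in> compact_ideal U T S"
proof -
  have tri: "triangulated_subcategory T S"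
    using sm by (simp add: smashing_subcategory_def strictly_localizing_subcategory_def
        localizing_subcategory_def)
  then have SO: "S \<subseteq> Ob T" by (simp add: triangulated_subcategory_def)
  obtain Go Ga \<epsilon> where c: "coreflection S Go Ga \<epsilon>" and
    cp: "\<And>X P \<iota>. is_coproduct T (UNIV :: nat set) X P \<iota>
      \<Longrightarrow> is_coproduct T UNIV (\<lambda>n. Go (X n)) (Go P) (\<lambda>n. Ga (\<iota> n))"
    using smashing_coreflection[OF sm] by metis
  note cD = coreflectionD[OF c]
  obtain P \<iota> \<Phi> g h where t: "telescope A \<phi> P \<iota> \<Phi>" and tr: "triangle P P X \<Phi> g h"
    using hc by (auto simp: is_hocolim_iff)
  note e = telescopeD[OF t] and q = triangleD[OF tr]
  have GO: "Go B \<in> Ob T" if "B \<in> Ob T" for B using cD(1)[OF that] SO by blast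
  have seq: "is_sequence T (\<lambda>n. Go (A n)) (\<lambda>n. Ga (\<phi> n))"
    using cD(3)[OF e(4)] GO e(6) by (simp add: is_sequence_def)
  \<comment> \<open>\<open>Go P\<close> itself is the coproduct of the \<open>Go (A n)\<close>, so
    the new telescope lives on it and \<open>\<epsilon> P\<close> can be compared with the telescope
    maps summand by summand.\<close>
  obtain \<Phi>' where t': "telescope (\<lambda>n. Go (A n)) (\<lambda>n. Ga (\<phi> n)) (Go P) (\<lambda>n. Ga (\<iota> n)) \<Phi>'"
    using telescope_ex[OF seq cp[OF e(2)]] by metis
  note e' = telescopeD[OF t']
  obtain X' g' h' where tr': "triangle (Go P) (Go P) X' \<Phi>' g' h'" using triangle_ex[OF e'(3)] by metis
  note q' = triangleD[OF tr']
  note ep = cD(2)[OF e(7)] and ea = cD(2)[OF e(6)]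
  note ei = cD(4)[OF e(5)] and ef = cD(4)[OF e(4)]
  have comm: "\<epsilon> P \<bullet> \<Phi>' = \<Phi> \<bullet> \<epsilon> P"
  proof (rule coproduct_eq[OF e'(2) Cmp_Hom[OF e'(3) ep] Cmp_Hom[OF ep e(3)]])
    fix i
    have 1: "\<epsilon> P \<bullet> (Ga (\<iota> (Suc i)) \<bullet> Ga (\<phi> i)) = (\<iota> (Suc i) \<bullet> \<phi> i) \<bullet> \<epsilon> (A i)"
      using Cmp_assoc[OF e'(4,5) ep, symmetric] ei[of "Suc i"] Cmp_assoc[OF e'(4) ea e(5)] ef[of i]
        Cmp_assoc[OF ea e(4) e(5)] by simp
    have "(\<epsilon> P \<bullet> \<Phi>') \<bullet> Ga (\<iota> i) = (\<iota> i \<bullet> \<epsilon> (A i)) \<boxplus> Neg T ((\<iota> (Suc i) \<bullet> \<phi> i) \<bullet> \<epsilon> (A i))"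
      using Cmp_assoc[OF e'(5,3) ep] e'(8)[of i] cmp_sub[OF e'(5) Cmp_Hom[OF e'(4,5)] ep] ei[of i] 1
      by simp
    also have "\<dots> = (\<Phi> \<bullet> \<iota> i) \<bullet> \<epsilon> (A i)"
      using sub_cmp[OF ea e(5) Cmp_Hom[OF e(4,5)]] e(8)[of i] by simp
    also have "\<dots> = (\<Phi> \<bullet> \<epsilon> P) \<bullet> Ga (\<iota> i)"
      using Cmp_assoc[OF ea e(5,3)] Cmp_assoc[OF e'(5) ep e(3)] ei[of i] by simp
    finally show "(\<epsilon> P \<bullet> \<Phi>') \<bullet> Ga (\<iota> i) = (\<Phi> \<bullet> \<epsilon> P) \<bullet> Ga (\<iota> i)" .
  qed
  obtain d where d: "d \<in> Hom T X' X" "d \<bullet> g' = g \<bullet> \<epsilon> P" "ShA T (\<epsilon> P) \<bullet> h' = h \<bullet> d"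
    using triangle_morphism[OF tr' tr ep ep comm] by metis
  obtain s where s: "s \<in> Hom T X X'" "d \<bullet> s = Ide T X"
    using coreflected_cone_section[OF tri c X tr tr' comm d] by metis
  have gi: "g \<bullet> \<iota> i \<in> Hom T (A i) X" for i using Cmp_Hom[OF e(5) q(2)] .
  have gi': "g' \<bullet> Ga (\<iota> i) \<in> Hom T (Go (A i)) X'" for i using Cmp_Hom[OF e'(5) q'(2)] .
  \<comment> \<open>The map from \<open>A n\<close> through \<open>X\<close> to \<open>X'\<close>
    has compact source, hence passes through some \<open>Go (A m)\<close>; this is the member of
    \<open>S\<close> in the final factorization.\<close>
  obtain m u where u: "u \<in> Hom T (A n) (Go (A m))" "s \<bullet> (g \<bullet> \<iota> n) = (g' \<bullet> Ga (\<iota> m)) \<bullet> u"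
    using compact_factors_through_stage[OF A t' tr' Cmp_Hom[OF gi s(1)]] by metis
  define w where "w = \<epsilon> (A m) \<bullet> u"
  have w: "w \<in> Hom T (A n) (A m)" using Cmp_Hom[OF u(1) ea] by (simp add: w_def)
  have "d \<bullet> (g' \<bullet> Ga (\<iota> m)) = (g \<bullet> \<iota> m) \<bullet> \<epsilon> (A m)"
    using Cmp_assoc[OF e'(5) q'(2) d(1), of m] d(2) Cmp_assoc[OF e'(5) ep q(2), of m] ei[of m]
      Cmp_assoc[OF ea e(5) q(2), of m] by metis
  \<comment> \<open>Composition with \<open>d\<close> undoes \<open>s\<close> and turns the passage
    through \<open>Go (A m)\<close> into one through \<open>A m\<close>.\<close>
  then have gw: "g \<bullet> \<iota> n = (g \<bullet> \<iota> m) \<bullet> w"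
    using Cmp_assoc[OF gi s(1) d(1), of n] s(2) Ide_Cmp[OF gi, of n] u(2) Cmp_assoc[OF u(1) gi' d(1)]
      Cmp_assoc[OF u(1) ea gi] unfolding w_def by metis
  define l where "l = max n m"
  have nl: "n \<le> l" and ml: "m \<le> l" by (auto simp: l_def)
  note pn = path_hom[OF e(1) nl] and pm = path_hom[OF e(1) ml]
  note pw = Cmp_Hom[OF w pm]
  note cone = telescope_cone_path[OF t q(2) triangle_cmp_zer[OF tr]]
  \<comment> \<open>The direct path and the detour through \<open>w\<close> agree in
    \<open>X\<close>; compactness of \<open>A n\<close> makes their difference vanish at a finite
    stage.\<close>
  have "(g \<bullet> \<iota> l) \<bullet> (path T A \<phi> n l \<boxplus> Neg T (path T A \<phi> m l \<bullet> w)) = Zer T (A n) X"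
    using cmp_sub[OF pn pw gi] cone[OF nl] cone[OF ml] Cmp_assoc[OF w pm gi, symmetric] gw
      add_neg[OF gi] by metis
  then obtain N where N: "l \<le> N" "\<And>k. N \<le> k
      \<Longrightarrow> path T A \<phi> l k \<bullet> (path T A \<phi> n l \<boxplus> Neg T (path T A \<phi> m l \<bullet> w)) = Zer T (A n) (A k)"
    using compact_vanishing_at_stage[OF A t tr add_hom[OF pn neg_hom[OF pw]]] by metis
  \<comment> \<open>\<open>N\<close> may equal \<open>n\<close>; the successor guarantees
    \<open>n < k\<close>.\<close>
  define k where "k = Suc N"
  have lk: "l \<le> k" and Nk: "N \<le> k" and nk: "n < k" and mk: "m \<le> k" using N(1) nl ml by (auto simp: k_def)
  note pl = path_hom[OF e(1) lk]
  have "path T A \<phi> n k \<boxplus> Neg T (path T A \<phi> m k \<bullet> w) = Zer T (A n) (A k)"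
    using N(2)[OF Nk] cmp_sub[OF pn pw pl] path_trans[OF e(1) nl lk] path_trans[OF e(1) ml lk]
      Cmp_assoc[OF w pm pl] by simp
  then have "path T A \<phi> n k = path T A \<phi> m k \<bullet> w"
    using sub_eq_zer[OF path_hom[OF e(1) less_imp_le[OF nk]] Cmp_Hom[OF w path_hom[OF e(1) mk]]] by simp
  also have "\<dots> = (path T A \<phi> m k \<bullet> \<epsilon> (A m)) \<bullet> u"
    using Cmp_assoc[OF u(1) ea path_hom[OF e(1) mk]] by (simp add: w_def)
  finally have fac: "path T A \<phi> n k = (path T A \<phi> m k \<bullet> \<epsilon> (A m)) \<bullet> u" .
  have "\<exists>Y\<in>S. \<exists>a\<in>Hom T (A n) Y. \<exists>b\<in>Hom T Y (A k). path T A \<phi> n k = b \<bullet> a"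
    by (intro bexI[where x = "Go (A m)"] bexI[where x = u]
        bexI[where x = "path T A \<phi> m k \<bullet> \<epsilon> (A m)"])
      (fact fac u(1) Cmp_Hom[OF ea path_hom[OF e(1) mk]] cD(1)[OF e(6)])+
  moreover have "path T A \<phi> n k \<in> Ar T" "Dom T (path T A \<phi> n k) = A n" "Cod T (path T A \<phi> n k) = A k"
    using path_hom[OF e(1) less_imp_le[OF nk]] by (auto simp: Hom_def)
  ultimately have "path T A \<phi> n k \<in> compact_ideal U T S"
    using A
    by (simp add: compact_ideal_def)
  then show ?thesis using nk by blast
qed

end

section \<open>The equivalence for countable objects\<close>

theorem theorem6p7:
  fixes T :: "('o, 'm) tricat" and U :: "'u set" and S :: "'o set" and X :: 'o
  assumes "compactly_generated_triangulated_category T U"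
    and "smashing_subcategory U T S"
    and "countable_object U T X"
  shows "X \<in> S \<longleftrightarrow>
    (\<exists>A \<phi>. (\<forall>n. A n \<in> compact_objects U T) \<and> (\<forall>n. \<phi> n \<in> Hom T (A n) (A (Suc n))) \<and>
      (\<forall>n. \<phi> n \<in> compact_ideal U T S) \<and> is_hocolim T A \<phi> X)"
proof
  interpret compactly_generated_triangulated_category T U by (fact assms(1))
  assume X: "X \<in> S"
  obtain A \<phi> X' where A: "\<And>n. A n \<in> compact_objects U T" and hc': "is_hocolim T A \<phi> X'"
    and iso: "isomorphic T X X'"
    using assms(3) unfolding countable_object_def by blast
  \<comment> \<open>\<open>X\<close> is only isomorphic to the given homotopy colimit; replacing the
    cone makes \<open>X\<close> itself one.\<close>
  obtain d where d: "is_iso_arrow T X' X d" using isomorphic_sym[OF iso] by (auto simp: isomorphic_def)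
  have hc: "is_hocolim T A \<phi> X" using hc' triangle_replace_cone[OF _ d] unfolding is_hocolim_iff by metis
  have s: "is_sequence T A \<phi>" using hc by (simp add: is_hocolim_def)
  obtain f where f: "\<And>n. n < f n \<and> path T A \<phi> n (f n) \<in> compact_ideal U T S"
    using hocolim_paths_in_ideal[OF assms(2) X hc A] by metis
  \<comment> \<open>Iterating \<open>f\<close> from stage 0 makes each step of the subsequence a
    path that lies in the ideal.\<close>
  define r where "r = rec_nat 0 (\<lambda>_. f)"
  have rS: "r (Suc k) = f (r k)" for k by (simp add: r_def)
  have r: "strict_mono r" using f rS by (simp add: strict_mono_Suc_iff)
  let ?\<psi> = "\<lambda>k. path T A \<phi> (r k) (r (Suc k))"
  have "?\<psi> k \<in> Hom T (A (r k)) (A (r (Suc k)))" for k using subsequence[OF s r] by (simp add: is_sequence_def)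
  moreover have "?\<psi> k \<in> compact_ideal U T S" for k using f[of "r k"] rS by simp
  ultimately show "\<exists>A \<phi>. (\<forall>n. A n \<in> compact_objects U T) \<and> (\<forall>n. \<phi> n \<in> Hom T (A n) (A (Suc n))) \<and>
      (\<forall>n. \<phi> n \<in> compact_ideal U T S) \<and> is_hocolim T A \<phi> X"
    using A hocolim_subsequence[OF hc r]
    by (intro exI[of _ "\<lambda>k. A (r k)"] exI[of _ ?\<psi>]) simp
next
  interpret compactly_generated_triangulated_category T U by (fact assms(1))
  assume "\<exists>A \<phi>. (\<forall>n. A n \<in> compact_objects U T) \<and> (\<forall>n. \<phi> n \<in> Hom T (A n) (A (Suc n))) \<and>
      (\<forall>n. \<phi> n \<in> compact_ideal U T S) \<and> is_hocolim T A \<phi> X"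
  then obtain A \<phi> where p: "\<And>n. \<phi> n \<in> Hom T (A n) (A (Suc n))"
    and i: "\<And>n. \<phi> n \<in> compact_ideal U T S" and hc: "is_hocolim T A \<phi> X" by blast
  have dc: "Dom T (\<phi> n) = A n" "Cod T (\<phi> n) = A (Suc n)" for n using p[of n] by (auto simp: Hom_def)
  have "\<exists>Y \<in> S. \<exists>a \<in> Hom T (A n) Y. \<exists>b \<in> Hom T Y (A (Suc n)). \<phi> n = b \<bullet>\<^bsub>T\<^esub> a" for n
    using i[of n] by (simp add: compact_ideal_def dc)
  moreover have "localizing_subcategory U T S"
    using assms(2) by (simp add: smashing_subcategory_def strictly_localizing_subcategory_def)
  ultimately show "X \<in> S" using hocolim_in_localizing[OF _ hc] by blast
qed

end
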